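(* Let $S$ be a countably based, simple, stably finite Cu-semigroup satisfying (O5) and (O6+), let $u\in S$ be a compact, full element, and set $K:=F_{u\mapsto 1}(S)$. Assume that $S$ satisfies Edwards' condition for $\partial_e K$. Then for every $a,b\in S$ there exists $c\in S$ satisfying $c\leq a$, $c\leq b$ and $\widehat{c}_{|K}=\widehat{a}_{|K}\wedge\widehat{b}_{|K}$, where $\wedge$ denotes the infimum in $\mathrm{LAff}(K)$.
   Context: A positively ordered monoid is a commutative monoid $S$ with a translation-invariant partial order such that $0\leq a$ for all $a$. In $S$, $a\ll b$ means: for every increasing sequence $(b_n)_n$ whose supremum exists and satisfies $b\leq\sup_n b_n$, there is $N$ with $a\leq b_N$. A Cu-semigroup is a positively ordered monoid $S$ with: (O1) every increasing sequence has a supremum; (O2) every element is the supremum of a $\ll$-increasing sequence; (O3) $a'\ll a$, $b'\ll b$ imply $a'+b'\ll a+b$; (O4) $\sup_n(a_n+b_n)=\sup_na_n+\sup_nb_n$ for increasing sequences. Further axioms: (O5) if $a+b\leq c$, $a'\ll a$, $b'\ll b$, then there is $x\in S$ with $a'+x\leq c\leq a+x$ and $b'\ll x$. (O6+) if $a\leq b+c$, $x'\ll x\leq a,b$, $y'\ll y\leq a,c$, then there are $e,f\in S$ with $a\leq e+f$, $x'\ll e\leq a,b$, $y'\ll f\leq a,c$. ($x\leq a,b$ means $x\leq a$ and $x\leq b$.) $S$ is countably based if there is a countable subset such that every element of $S$ is the supremum of an increasing sequence from it. An ideal is a downward hereditary submonoid closed under suprema of increasing sequences; $S$ is simple if its only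 ideals are $\{0\}$ and $S$; an element $u$ is full if $\sup_n nu$ is the largest element of $S$. An element $a$ is finite if $a\neq a+b$ for every $b\neq0$; $S$ is stably finite if $a$ is finite whenever $a\ll\tilde a$ for some $\tilde a\in S$. $u$ is compact if $u\ll u$. A functional on $S$ is a map $\lambda\colon S\to[0,\infty]$ preserving addition, order, zero and suprema of increasing sequences; $F(S)$ is the set of functionals, with the compact Hausdorff topology in which $\lambda_j\to\lambda$ iff $\limsup_j\lambda_j(a')\leq\lambda(a)\leq\liminf_j\lambda_j(a)$ for all $a'\ll a$. $F_{u\mapsto1}(S):=\{\lambda\in F(S):\lambda(u)=1\}$; under the present hypotheses $K$ is a metrizable Choquet simplex with extreme boundary $\partial_eK$. For $a\in S$, $\widehat a(\lambda):=\lambda(a)$. $S$ satisfies Edwards' condition for $\partial_eK$ if $\min\{\lambda(a),\lambda(b)\}=\sup\{\lambda(c):c\in S,\ c\leq a,b\}$ for all $\lambda\in\partial_eK$ and $a,b\in S$. $\mathrm{LAff}(K)$ is the set of lower semicontinuous affine functions $K\to(-\infty,\infty]$ with pointwise order. Since $K$ is a Choquet simplex, any two elements of $\mathrm{LAff}(K)$ have an infimum $f\wedge g$ in $\mathrm{LAff}(K)$ (in general not the pointwise infimum). *)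

theory Defs
  imports "HOL-Analysis.Analysis"
begin

section \<open>Cu-semigroups\<close>

class positively_ordered_monoid = ordered_comm_monoid_add +
  assumes zero_least: "0 \<le> a"

context order
begin

text \<open>The element \<open>s\<close> is the supremum of the sequence \<open>b\<close>; suprema need not exist.\<close>

definition is_seq_sup :: "(nat \<Rightarrow> 'a) \<Rightarrow> 'a \<Rightarrow> bool" where
  "is_seq_sup b s \<longleftrightarrow> (\<forall>n. b n \<le> s) \<and> (\<forall>t. (\<forall>n. b n \<le> t) \<longrightarrow> s \<le> t)"

definition way_below :: "'a \<Rightarrow> 'a \<Rightarrow> bool"  (infix \<open>\<lless>\<close> 50) where
  "a \<lless> b \<longleftrightarrow>
     (\<forall>f s. (\<forall>n. f n \<le> f (Suc n)) \<and> is_seq_sup f s \<and> b \<le> s \<longrightarrow> (\<exists>N. a \<le> f N))"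

end

class cu_semigroup = positively_ordered_monoid +
  assumes O1: "(\<forall>n. f n \<le> f (Suc n)) \<Longrightarrow> \<exists>s. is_seq_sup f s"
    and O2: "\<exists>f. (\<forall>n. f n \<lless> f (Suc n)) \<and> is_seq_sup f a"
    and O3: "a' \<lless> a \<Longrightarrow> b' \<lless> b \<Longrightarrow> a' + b' \<lless> a + b"
    and O4: "(\<forall>n. f n \<le> f (Suc n)) \<Longrightarrow> (\<forall>n. g n \<le> g (Suc n)) \<Longrightarrow>
        is_seq_sup f s \<Longrightarrow> is_seq_sup g t \<Longrightarrow> is_seq_sup (\<lambda>n. f n + g n) (s + t)"

text \<open>A Cu-semigroup \<open>S\<close> is a type of class \<open>cu_semigroup\<close>. Properties of \<open>S\<close> are
  predicates on \<open>TYPE('a)\<close>.\<close>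

definition axiom_O5 :: "'a::cu_semigroup itself \<Rightarrow> bool" where
  "axiom_O5 _ \<longleftrightarrow> (\<forall>a b c a' b' :: 'a. a + b \<le> c \<and> a' \<lless> a \<and> b' \<lless> b \<longrightarrow>
     (\<exists>x. a' + x \<le> c \<and> c \<le> a + x \<and> b' \<lless> x))"

definition axiom_O6_plus :: "'a::cu_semigroup itself \<Rightarrow> bool" where
  "axiom_O6_plus _ \<longleftrightarrow> (\<forall>a b c x' x y' y :: 'a.
     a \<le> b + c \<and> x' \<lless> x \<and> x \<le> a \<and> x \<le> b \<and> y' \<lless> y \<and> y \<le> a \<and> y \<le> c \<longrightarrow>
     (\<exists>e f. a \<le> e + f \<and> x' \<lless> e \<and> e \<le> a \<and> e \<le> b \<and> y' \<lless> f \<and> f \<le> a \<and> f \<le> c))"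

definition countably_based :: "'a::cu_semigroup itself \<Rightarrow> bool" where
  "countably_based _ \<longleftrightarrow> (\<exists>B :: 'a set. countable B \<and>
     (\<forall>a. \<exists>f. (\<forall>n. f n \<in> B) \<and> (\<forall>n. f n \<le> f (Suc n)) \<and> is_seq_sup f a))"

definition cu_ideal :: "'a::cu_semigroup set \<Rightarrow> bool" where
  "cu_ideal I \<longleftrightarrow> 0 \<in> I \<and> (\<forall>a\<in>I. \<forall>b\<in>I. a + b \<in> I) \<and> (\<forall>b\<in>I. \<forall>a. a \<le> b \<longrightarrow> a \<in> I) \<and>
     (\<forall>f s. (\<forall>n. f n \<in> I) \<and> (\<forall>n. f n \<le> f (Suc n)) \<and> is_seq_sup f s \<longrightarrow> s \<in> I)"

definition simple_cu :: "'a::cu_semigroup itself \<Rightarrow> bool" where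
  "simple_cu _ \<longleftrightarrow> (\<forall>I :: 'a set. cu_ideal I \<longrightarrow> I = {0} \<or> I = UNIV)"

definition full_element :: "'a::cu_semigroup \<Rightarrow> bool" where
  "full_element u \<longleftrightarrow> (\<exists>s. is_seq_sup (\<lambda>n. \<Sum>i<n. u) s \<and> (\<forall>x. x \<le> s))"

definition compact_element :: "'a::cu_semigroup \<Rightarrow> bool" where
  "compact_element u \<longleftrightarrow> u \<lless> u"

definition finite_element :: "'a::cu_semigroup \<Rightarrow> bool" where
  "finite_element a \<longleftrightarrow> (\<forall>b. b \<noteq> 0 \<longrightarrow> a \<noteq> a + b)"

definition stably_finite :: "'a::cu_semigroup itself \<Rightarrow> bool" where
  "stably_finite _ \<longleftrightarrow> (\<forall>a b :: 'a. a \<lless> b \<longrightarrow> finite_element a)"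


section \<open>Functionals\<close>

definition functionals :: "('a::cu_semigroup \<Rightarrow> ennreal) set" where
  "functionals = {l. l 0 = 0 \<and> (\<forall>a b. l (a + b) = l a + l b) \<and> (\<forall>a b. a \<le> b \<longrightarrow> l a \<le> l b) \<and>
     (\<forall>f s. (\<forall>n. f n \<le> f (Suc n)) \<and> is_seq_sup f s \<longrightarrow> is_seq_sup (\<lambda>n. l (f n)) (l s))}"

definition functional_converges ::
    "('i \<Rightarrow> 'a::cu_semigroup \<Rightarrow> ennreal) \<Rightarrow> ('a \<Rightarrow> ennreal) \<Rightarrow> 'i filter \<Rightarrow> bool" where
  "functional_converges L l F \<longleftrightarrow>
     (\<forall>a' a. a' \<lless> a \<longrightarrow> Limsup F (\<lambda>j. L j a') \<le> l a \<and> l a \<le> Liminf F (\<lambda>j. L j a))"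

text \<open>The topology of \<open>F(S)\<close> is determined by its convergent nets, for which we use filters: a set
  is open iff every filter on \<open>F(S)\<close> converging to a point of the set eventually lies in it. That
  convergence in this topology is exactly the prescribed one is shown in
  \<open>limitin_functional_topology\<close> below.\<close>

definition functional_topology :: "('a::cu_semigroup \<Rightarrow> ennreal) topology" where
  "functional_topology = topology (\<lambda>U. U \<subseteq> functionals \<and>
     (\<forall>l\<in>U. \<forall>F. F \<le> principal functionals \<and> functional_converges (\<lambda>m. m) l F \<longrightarrow>
        eventually (\<lambda>m. m \<in> U) F))"

definition normalized_functionals :: "'a::cu_semigroup \<Rightarrow> ('a \<Rightarrow> ennreal) set" where
  "normalized_functionals u = {l \<in> functionals. l u = 1}"

definition convex_comb ::
    "real \<Rightarrow> ('a::cu_semigroup \<Rightarrow> ennreal) \<Rightarrow> ('a \<Rightarrow> ennreal) \<Rightarrow> 'a \<Rightarrow> ennreal" where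
  "convex_comb t l m = (\<lambda>a. ennreal t * l a + ennreal (1 - t) * m a)"

text \<open>The library notion \<open>extreme_point_of\<close> requires a real vector space, whereas functionals
  only form a cone.\<close>

definition extreme_boundary ::
    "('a::cu_semigroup \<Rightarrow> ennreal) set \<Rightarrow> ('a \<Rightarrow> ennreal) set" where
  "extreme_boundary K = {l \<in> K. \<forall>m\<in>K. \<forall>n\<in>K. \<forall>t. 0 < t \<and> t < 1 \<and> l = convex_comb t m n \<longrightarrow>
     m = l \<and> n = l}"

definition edwards_condition :: "('a::cu_semigroup \<Rightarrow> ennreal) set \<Rightarrow> bool" where
  "edwards_condition E \<longleftrightarrow>
     (\<forall>l\<in>E. \<forall>a b. min (l a) (l b) = Sup {l c | c. c \<le> a \<and> c \<le> b})"


section \<open>Lower semicontinuous affine functions\<close>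

text \<open>Functions on \<open>K\<close> are extensional, i.e. \<open>undefined\<close> outside \<open>K\<close>.\<close>

definition LAff :: "('a::cu_semigroup \<Rightarrow> ennreal) set \<Rightarrow> (('a \<Rightarrow> ennreal) \<Rightarrow> ereal) set" where
  "LAff K = {f \<in> K \<rightarrow>\<^sub>E {-\<infinity><..}.
     (\<forall>r. openin (subtopology functional_topology K) {l \<in> K. r < f l}) \<and>
     (\<forall>l\<in>K. \<forall>m\<in>K. \<forall>t. 0 \<le> t \<and> t \<le> 1 \<longrightarrow>
        f (convex_comb t l m) = ereal t * f l + ereal (1 - t) * f m)}"

text \<open>\<open>h\<close> is the infimum \<open>f \<and> g\<close> in \<open>LAff(K)\<close> with respect to the pointwise order.\<close>

definition is_LAff_inf :: "('a::cu_semigroup \<Rightarrow> ennreal) set \<Rightarrow> (('a \<Rightarrow> ennreal) \<Rightarrow> ereal) \<Rightarrow>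
    (('a \<Rightarrow> ennreal) \<Rightarrow> ereal) \<Rightarrow> (('a \<Rightarrow> ennreal) \<Rightarrow> ereal) \<Rightarrow> bool" where
  "is_LAff_inf K f g h \<longleftrightarrow> h \<in> LAff K \<and> (\<forall>l\<in>K. h l \<le> f l) \<and> (\<forall>l\<in>K. h l \<le> g l) \<and>
     (\<forall>k\<in>LAff K. (\<forall>l\<in>K. k l \<le> f l) \<and> (\<forall>l\<in>K. k l \<le> g l) \<longrightarrow> (\<forall>l\<in>K. k l \<le> h l))"

definition hat :: "'a::cu_semigroup \<Rightarrow> ('a \<Rightarrow> ennreal) \<Rightarrow> ereal" where
  "hat a = (\<lambda>l. enn2ereal (l a))"


section \<open>Convergence in the topology of functionals\<close>

lemma istopology_functional:
  "istopology (\<lambda>U. U \<subseteq> (functionals :: ('a::cu_semigroup \<Rightarrow> ennreal) set) \<and>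
     (\<forall>l\<in>U. \<forall>F. F \<le> principal functionals \<and> functional_converges (\<lambda>m. m) l F \<longrightarrow>
        eventually (\<lambda>m. m \<in> U) F))"
proof -
  have "eventually (\<lambda>m. m \<in> \<Union>\<K>) F" if "eventually (\<lambda>m. m \<in> U) F" "U \<in> \<K>"
    for \<K> :: "('a \<Rightarrow> ennreal) set set" and U F
    using that by (auto elim: eventually_mono)
  then show ?thesis
    unfolding istopology_def
    apply (intro conjI allI impI)
    subgoal by blast
    subgoal by (auto intro: eventually_conj)
    subgoal by blast
    subgoal by (meson UnionE)
    done
qed

lemma openin_functional_topology:
  "openin functional_topology U \<longleftrightarrow> U \<subseteq> functionals \<and>
     (\<forall>l\<in>U. \<forall>F. F \<le> principal functionals \<and> functional_converges (\<lambda>m. m) l F \<longrightarrow>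
        eventually (\<lambda>m. m \<in> U) F)"
  by (simp add: functional_topology_def topology_inverse'[OF istopology_functional])

lemma topspace_functional_topology: "topspace functional_topology = functionals"
proof -
  have "openin functional_topology functionals"
    by (auto simp: openin_functional_topology le_principal)
  then show ?thesis
    by (meson openin_functional_topology openin_subset openin_topspace subset_antisym)
qed

lemma way_below_imp_le:
  fixes a b :: "'a::order"
  assumes "a \<lless> b"
  shows "a \<le> b"
proof -
  have "is_seq_sup (\<lambda>n. b) b" by (simp add: is_seq_sup_def)
  then show ?thesis
    using assms[unfolded way_below_def, rule_format, of "\<lambda>n. b" b] by simp
qed

lemma way_below_le_trans:
  fixes a b c d :: "'a::order"
  assumes "a \<le> b" "b \<lless> c" "c \<le> d"
  shows "a \<lless> d"
  unfolding way_below_def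
proof (intro allI impI)
  fix f s assume f: "(\<forall>n. f n \<le> f (Suc n)) \<and> is_seq_sup f s \<and> d \<le> s"
  then have "\<exists>N. b \<le> f N"
    using assms(2)[unfolded way_below_def, rule_format, of f s] order_trans[OF assms(3), of s]
      f by simp
  then show "\<exists>N. a \<le> f N" using assms(1) order_trans by blast
qed

lemma way_below_interpolation:
  fixes a' a :: "'a::cu_semigroup"
  assumes "a' \<lless> a"
  shows "\<exists>b. a' \<lless> b \<and> b \<lless> a"
proof -
  obtain f where f: "\<And>n. f n \<lless> f (Suc n)" and s: "is_seq_sup f a"
    using O2[of a] by blast
  obtain N where N: "a' \<le> f N"
    using assms s way_below_imp_le[OF f] unfolding way_below_def by blast
  have "a' \<lless> f (Suc N)"
    using way_below_le_trans[OF N f order_refl] .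
  moreover have "f (Suc N) \<lless> a"
    using s by (intro way_below_le_trans[OF order_refl f]) (simp add: is_seq_sup_def)
  ultimately show ?thesis by blast
qed

lemma limitin_functional_topology:
  fixes l :: "'a::cu_semigroup \<Rightarrow> ennreal"
  assumes L: "\<And>j. L j \<in> functionals" and l: "l \<in> functionals"
  shows "limitin functional_topology L l F \<longleftrightarrow> functional_converges L l F"
proof
  assume lim: "limitin functional_topology L l F"
  show "functional_converges L l F"
    unfolding functional_converges_def
  proof (intro allI impI conjI)
    fix a' a :: 'a assume aa: "a' \<lless> a"
    show "Limsup F (\<lambda>j. L j a') \<le> l a"
    proof (rule dense_ge)
      fix t assume t: "l a < t"
      define U where "U = {m \<in> functionals. \<exists>b. a' \<lless> b \<and> m b < t}"
      have "openin functional_topology U"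
        unfolding openin_functional_topology
      proof (intro conjI ballI allI impI)
        show "U \<subseteq> functionals" by (auto simp: U_def)
        fix m G assume m: "m \<in> U" and
          G: "G \<le> principal functionals \<and> functional_converges (\<lambda>m. m) m G"
        obtain b where b: "a' \<lless> b" "m b < t" using m by (auto simp: U_def)
        obtain c where c: "a' \<lless> c" "c \<lless> b" using way_below_interpolation[OF b(1)] by blast
        have "Limsup G (\<lambda>m. m c) < t"
          using G c(2) b(2) unfolding functional_converges_def by (meson order_le_less_trans)
        then have "eventually (\<lambda>m. m c < t) G"
          by (rule Limsup_lessD)
        moreover have "eventually (\<lambda>m. m \<in> functionals) G"
          using G by (simp add: le_principal)
        ultimately show "eventually (\<lambda>m. m \<in> U) G"
          by eventually_elim (use c in \<open>auto simp: U_def\<close>)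
      qed
      moreover have "l \<in> U" using l aa t by (auto simp: U_def)
      ultimately have "eventually (\<lambda>j. L j \<in> U) F" using lim by (simp add: limitin_def)
      then have "eventually (\<lambda>j. L j a' \<le> t) F"
      proof eventually_elim
        case (elim j)
        then obtain b where b: "a' \<lless> b" "L j b < t" by (auto simp: U_def)
        have "a' \<le> b"
          using b(1) by (rule way_below_imp_le)
        then have "L j a' \<le> L j b" using L[of j] by (auto simp: functionals_def)
        then show ?case using b by simp
      qed
      then show "Limsup F (\<lambda>j. L j a') \<le> t" by (rule Limsup_bounded)
    qed
    show "l a \<le> Liminf F (\<lambda>j. L j a)"
    proof (rule dense_le)
      fix t assume t: "t < l a"
      define U where "U = {m \<in> functionals. t < m a}"
      have "openin functional_topology U"
        unfolding openin_functional_topology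
      proof (intro conjI ballI allI impI)
        show "U \<subseteq> functionals" by (auto simp: U_def)
        fix m G assume m: "m \<in> U" and
          G: "G \<le> principal functionals \<and> functional_converges (\<lambda>m. m) m G"
        have "t < Liminf G (\<lambda>m. m a)"
          using G m aa unfolding functional_converges_def U_def
          by (metis (mono_tags, lifting) mem_Collect_eq order_less_le_trans)
        then have "eventually (\<lambda>m. t < m a) G"
          by (rule less_LiminfD)
        moreover have "eventually (\<lambda>m. m \<in> functionals) G"
          using G by (simp add: le_principal)
        ultimately show "eventually (\<lambda>m. m \<in> U) G"
          by eventually_elim (auto simp: U_def)
      qed
      moreover have "l \<in> U" using l t by (auto simp: U_def)
      ultimately have "eventually (\<lambda>j. L j \<in> U) F" using lim by (simp add: limitin_def)
      then have "eventually (\<lambda>j. t \<le> L j a) F"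
        by eventually_elim (auto simp: U_def)
      then show "t \<le> Liminf F (\<lambda>j. L j a)" by (rule Liminf_bounded)
    qed
  qed
next
  assume conv: "functional_converges L l F"
  have "functional_converges (\<lambda>m. m) l (filtermap L F)"
    using conv by (simp add: functional_converges_def Limsup_le_iff le_Liminf_iff eventually_filtermap)
  moreover have "filtermap L F \<le> principal functionals"
    using L by (simp add: le_principal eventually_filtermap)
  ultimately have "eventually (\<lambda>m. m \<in> U) (filtermap L F)"
    if "openin functional_topology U" "l \<in> U" for U
    using that unfolding openin_functional_topology by blast
  then have "eventually (\<lambda>j. L j \<in> U) F"
    if "openin functional_topology U" "l \<in> U" for U
    using that by (simp add: eventually_filtermap)
  then show "limitin functional_topology L l F"
    using l by (simp add: limitin_def topspace_functional_topology)
qed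

end

theory Submission
  imports Defs
begin

text \<open>
  If \<open>a \<le> b + r\<close> and \<open>x \<lless> e \<le> a, b\<close>, then (O6+) gives \<open>e' \<le> a, b\<close> with \<open>x \<lless> e'\<close> and
  \<open>a \<le> e' + r\<close> at every functional. So one can improve a common lower bound uniformly on \<open>K\<close> while
  staying above any given element way below it. Running through the countably many relevant \<open>r\<close>
  produces a common lower bound \<open>c\<close> with \<open>l a \<le> l c + l r\<close> for all \<open>l \<in> K\<close> and all \<open>r\<close> with
  \<open>a \<le> b + r\<close> (up to replacing \<open>a\<close> by elements below it when \<open>l a = \<infinity>\<close>). At an extreme point, Edwards'
  condition and (O5) yield \<open>r\<close> with \<open>l r\<close> close to \<open>l a - min (l a) (l b)\<close>, whence
  \<open>min (l a) (l b) \<le> l c\<close>. Finally, if \<open>k \<in> LAff K\<close> lies below \<open>c\<close> on the extreme boundary, it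
  lies below \<open>c\<close> on \<open>K\<close>: approximate \<open>k\<close> from below by convex upper semicontinuous functions and
  apply Bauer's minimum principle.
\<close>

section \<open>Way-below relation and functionals\<close>

lemma zero_way_below: "0 \<lless> (a::'a::positively_ordered_monoid)"
  by (simp add: way_below_def zero_least)

lemma way_below_imp_seq:
  fixes a b :: "'a::order"
  assumes "a \<lless> b" "\<And>n. f n \<le> f (Suc n)" "is_seq_sup f s" "b \<le> s"
  shows "\<exists>N. a \<le> f N"
  using assms unfolding way_below_def by blast

lemma way_below_approx:
  fixes a :: "'a::cu_semigroup"
  obtains f where "\<And>n. f n \<lless> f (Suc n)" "\<And>n. f n \<le> f (Suc n)" "\<And>n. f n \<lless> a" "is_seq_sup f a"
proof -
  obtain f where f: "\<And>n. f n \<lless> f (Suc n)" "is_seq_sup f a"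
    using O2[of a] by blast
  moreover have "f n \<lless> a" for n
    using f by (intro way_below_le_trans[OF order_refl f(1)]) (simp add: is_seq_sup_def)
  ultimately show ?thesis using that way_below_imp_le by blast
qed

text \<open>The terms of an (O2) sequence for \<open>a\<close> are way below \<open>a\<close>; each
  of \<open>p\<close>, \<open>q\<close> lies below some term, and the later of the two terms serves
  for both.\<close>

lemma way_below_directed:
  fixes a p q :: "'a::cu_semigroup"
  assumes "p \<lless> a" "q \<lless> a"
  obtains b where "p \<le> b" "q \<le> b" "b \<lless> a"
proof -
  obtain f where f: "\<And>n. f n \<le> f (Suc n)" "\<And>n. f n \<lless> a" "is_seq_sup f a"
    using way_below_approx by metis
  obtain m n where "p \<le> f m" "q \<le> f n" using way_below_imp_seq[OF _ f(1,3) order_refl] assms by metis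
  moreover have "incseq f" using f(1) by (rule incseq_SucI)
  ultimately have "p \<le> f (max m n)" "q \<le> f (max m n)"
    by (meson incseqD max.cobounded1 max.cobounded2 order_trans)+
  then show ?thesis using that f(2) by blast
qed

lemma functionals_zero: "l \<in> functionals \<Longrightarrow> l 0 = 0"
  and functionals_add: "l \<in> functionals \<Longrightarrow> l (a + b) = l a + l b"
  and functionals_mono: "l \<in> functionals \<Longrightarrow> a \<le> b \<Longrightarrow> l a \<le> l b"
  unfolding functionals_def by blast+

lemma functionals_SUP:
  assumes "l \<in> functionals" "\<And>n. f n \<le> f (Suc n)" "is_seq_sup f s"
  shows "l s = (SUP n. l (f n))"
proof -
  have "is_seq_sup (\<lambda>n. l (f n)) (l s)" using assms by (auto simp: functionals_def)
  then show ?thesis unfolding is_seq_sup_def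
    by (intro antisym SUP_least) (metis SUP_upper UNIV_I, blast)
qed

lemma functionals_approx:
  assumes "l \<in> functionals" "t < l a"
  obtains b where "b \<lless> a" "t < l b"
proof -
  obtain f where f: "\<And>n. f n \<le> f (Suc n)" "\<And>n. f n \<lless> a" "is_seq_sup f a"
    using way_below_approx by metis
  then have "t < (SUP n. l (f n))" using functionals_SUP assms by metis
  then show ?thesis using that f(2) by (auto simp: less_SUP_iff)
qed

lemma functional_converges_liminf:
  assumes "functional_converges L l F" "t < l a"
  shows "\<forall>\<^sub>F j in F. t < L j a"
proof -
  \<comment> \<open>Convergence states this bound alongside a pair \<open>a' \<lless> a\<close>; the
    choice \<open>a' = 0\<close> makes it available for every \<open>a\<close>.\<close>
  have "l a \<le> Liminf F (\<lambda>j. L j a)"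
    using assms(1) zero_way_below[of a] unfolding functional_converges_def by blast
  then show ?thesis using assms(2) by (intro less_LiminfD) simp
qed

lemma functional_converges_subseq:
  fixes X :: "nat \<Rightarrow> 'a::cu_semigroup \<Rightarrow> ennreal"
  assumes "functional_converges X l sequentially" "strict_mono r"
  shows "functional_converges (X \<circ> r) l sequentially"
  unfolding functional_converges_def
proof (intro allI impI conjI)
  fix a' a :: 'a assume a: "a' \<lless> a"
  have "limsup (\<lambda>j. (X \<circ> r) j a') \<le> limsup (\<lambda>j. X j a')"
    using limsup_subseq_mono[OF assms(2), of "\<lambda>j. X j a'"] by (simp add: o_def)
  also have "\<dots> \<le> l a" using assms(1) a by (simp add: functional_converges_def)
  finally show "limsup (\<lambda>j. (X \<circ> r) j a') \<le> l a" .
  have "l a \<le> liminf (\<lambda>j. X j a)" using assms(1) a by (auto simp: functional_converges_def)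
  also have "\<dots> \<le> liminf (\<lambda>j. (X \<circ> r) j a)"
    using liminf_subseq_mono[OF assms(2), of "\<lambda>j. X j a"] by (simp add: o_def)
  finally show "l a \<le> liminf (\<lambda>j. (X \<circ> r) j a)" .
qed

lemma functionalsI:
  assumes "l 0 = 0" "\<And>a b. l (a + b) = l a + l b" "\<And>a b. a \<le> b \<Longrightarrow> l a \<le> l b"
    and "\<And>f s. (\<And>n. f n \<le> f (Suc n)) \<Longrightarrow> is_seq_sup f s \<Longrightarrow> l s \<le> (SUP n. l (f n))"
  shows "l \<in> functionals"
proof -
  have "is_seq_sup (\<lambda>n. l (f n)) (l s)" if "\<And>n. f n \<le> f (Suc n)" "is_seq_sup f s" for f s
  proof -
    have "l s \<le> t" if "\<forall>n. l (f n) \<le> t" for t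
      using assms(4)[OF \<open>\<And>n. f n \<le> f (Suc n)\<close> \<open>is_seq_sup f s\<close>] that
      by (meson SUP_least order_trans)
    then show ?thesis
      using that assms(3) by (auto simp: is_seq_sup_def)
  qed
  then show ?thesis using assms by (auto simp: functionals_def)
qed

text \<open>The test value 0 keeps the index sets nonempty when \<open>a\<close> or \<open>b\<close>
  is 0. Their suprema are \<open>a\<close> and \<open>b\<close>, and addition in
  \<open>ennreal\<close> commutes with nonempty suprema.\<close>

lemma ennreal_add_leI_dense:
  fixes a b c d :: ennreal
  assumes "\<And>v w. v = 0 \<or> v < a \<Longrightarrow> w = 0 \<or> w < b \<Longrightarrow> v + w + c \<le> d"
  shows "a + (b + c) \<le> d"
proof -
  have S: "(SUP v\<in>{v. v = 0 \<or> v < a}. v) = a" for a :: ennreal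
  proof (intro antisym SUP_least)
    show "a \<le> (SUP v\<in>{v. v = 0 \<or> v < a}. v)"
      by (rule dense_le, rule SUP_upper) auto
  qed auto
  have ne: "{v. v = 0 \<or> v < x} \<noteq> {}" for x :: ennreal by blast
  have "(SUP v\<in>{v. v = 0 \<or> v < a}. v) + ((SUP w\<in>{w. w = 0 \<or> w < b}. w) + c) \<le> d"
    unfolding ennreal_SUP_add_left[OF ne, symmetric] ennreal_SUP_add_right[OF ne]
    by (intro SUP_least) (use assms in \<open>auto simp: add.assoc\<close>)
  then show ?thesis unfolding S .
qed

text \<open>For finite \<open>z\<close>, both excesses over \<open>z\<close> are nonnegative while
  their sum with positive weights is at most 0, so each vanishes. This is what makes the minimizers
  of a concave function a face.\<close>

lemma ereal_convex_combination_eq: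
  fixes x y z :: ereal
  assumes t: "0 < t" "t < 1" and le: "ereal t * x + ereal (1 - t) * y \<le> z" "z \<le> x" "z \<le> y"
    and fin: "x \<noteq> - \<infinity>" "y \<noteq> - \<infinity>"
  shows "x = z \<and> y = z"
proof (cases "z = \<infinity>")
  case False
  have "x \<noteq> \<infinity>" "y \<noteq> \<infinity>" using le(1) t fin False by (cases x; cases y; auto)+
  then obtain a b where ab: "x = ereal a" "y = ereal b" using fin by (cases x; cases y; auto)
  then have "z \<noteq> - \<infinity>" using le(1) by auto
  then obtain c where c: "z = ereal c" using False by (cases z) auto
  have "t * (a - c) + (1 - t) * (b - c) \<le> 0" "0 \<le> a - c" "0 \<le> b - c"
    using le by (simp_all add: ab c algebra_simps)
  moreover have "0 \<le> t * (a - c)" "0 \<le> (1 - t) * (b - c)" using t calculation by simp_all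
  ultimately have "t * (a - c) = 0" "(1 - t) * (b - c) = 0" by linarith+
  then show ?thesis using t by (simp add: ab c)
qed (use le in auto)

section \<open>Sequential compactness\<close>

text \<open>Tychonoff replaces a diagonal argument: the countable power of \<open>ennreal\<close> is
  compact and first countable, hence sequentially compact.\<close>

lemma ennreal_sequence_compact:
  fixes X :: "nat \<Rightarrow> nat \<Rightarrow> ennreal"
  obtains r L where "strict_mono r" "\<And>n. (\<lambda>j. X (r j) n) \<longlonglongrightarrow> L n"
proof -
  have "compact (UNIV :: (nat \<Rightarrow> ennreal) set)"
  proof -
    have "compact_space (product_topology (\<lambda>i::nat. euclidean :: ennreal topology) UNIV)"
      unfolding compact_space_product_topology
      by (simp add: compact_space_def compactin_euclidean_iff compact_UNIV)
    then show ?thesis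
      by (simp add: euclidean_product_topology compact_space_def flip: compactin_euclidean_iff)
  qed
  then have "seq_compact (UNIV :: (nat \<Rightarrow> ennreal) set)" by (rule compact_imp_seq_compact)
  then obtain L r where r: "strict_mono r" "(X \<circ> r) \<longlonglongrightarrow> L"
    unfolding seq_compact_def by (metis UNIV_I)
  have "(\<lambda>j. X (r j) n) \<longlonglongrightarrow> L n" for n
    using continuous_on_tendsto_compose[OF continuous_on_product_coordinates[of n] r(2)]
    by (simp add: o_def)
  then show ?thesis using that r(1) by blast
qed

locale based_cu =
  fixes B :: "'a::cu_semigroup set"
  assumes countable_B: "countable B"
    and basis: "\<And>a. \<exists>f. (\<forall>n. f n \<in> B) \<and> (\<forall>n. f n \<le> f (Suc n)) \<and> is_seq_sup f a"
begin

text \<open>With \<open>a \<lless> d \<lless> e \<lless> c\<close>, a basis sequence increasing to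
  \<open>e\<close> has a term between \<open>d\<close> and \<open>e\<close>; the outer relations
  make it strictly interpolating.\<close>

lemma basis_interpolation:
  assumes "a \<lless> c"
  obtains b where "b \<in> B" "a \<lless> b" "b \<lless> c"
proof -
  obtain d where d: "a \<lless> d" "d \<lless> c" using way_below_interpolation[OF assms] by blast
  obtain e where e: "d \<lless> e" "e \<lless> c" using way_below_interpolation[OF d(2)] by blast
  obtain f where f: "\<And>n. f n \<in> B" "\<And>n. f n \<le> f (Suc n)" "is_seq_sup f e"
    using basis[of e] by blast
  obtain n where "d \<le> f n" using way_below_imp_seq[OF d(2), of f e]
    using way_below_imp_seq[OF e(1) f(2) f(3) order_refl] by blast
  moreover have "f n \<le> e" using f(3) by (simp add: is_seq_sup_def)
  ultimately show ?thesis
    using that[of "f n"] f(1) d(1) e(2) way_below_le_trans by blast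
qed

lemma functionals_le_basis:
  assumes "l \<in> functionals" "m \<in> functionals" "\<And>b. b \<in> B \<Longrightarrow> b \<lless> a \<Longrightarrow> l b \<le> m b"
  shows "l a \<le> m a"
proof (rule dense_le)
  fix t assume "t < l a"
  then obtain c where c: "c \<lless> a" "t < l c" using functionals_approx assms(1) by metis
  obtain b where b: "b \<in> B" "c \<lless> b" "b \<lless> a" using basis_interpolation c(1) by metis
  have "t < l c" by fact
  also have "l c \<le> l b" using functionals_mono[OF assms(1) way_below_imp_le[OF b(2)]] .
  also have "\<dots> \<le> m b" using assms(3) b by blast
  also have "\<dots> \<le> m a" using functionals_mono[OF assms(2) way_below_imp_le[OF b(3)]] .
  finally show "t \<le> m a" by simp
qed

text \<open>A subsequence converges pointwise on the countable basis, with limit \<open>L\<close>.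
  Regularizing \<open>L\<close> from below along \<lless> gives a functional, and the subsequence
  converges to it in the sense of \<open>functional_converges\<close>.\<close>

lemma functionals_seq_compact:
  fixes X :: "nat \<Rightarrow> 'a \<Rightarrow> ennreal"
  assumes X: "\<And>j. X j \<in> functionals"
  obtains r l where "strict_mono r" "l \<in> functionals" "functional_converges (X \<circ> r) l sequentially"
proof -
  define e where "e = from_nat_into B"
  obtain r E where r: "strict_mono r" and E: "\<And>n. (\<lambda>j. X (r j) (e n)) \<longlonglongrightarrow> E n"
    using ennreal_sequence_compact[of "\<lambda>j n. X j (e n)"] by metis
  have "\<exists>L. (\<lambda>j. X (r j) b) \<longlonglongrightarrow> L" if "b \<in> B" for b
    using E from_nat_into_surj[OF countable_B that] by (metis e_def)
  then obtain L where L: "\<And>b. b \<in> B \<Longrightarrow> (\<lambda>j. X (r j) b) \<longlonglongrightarrow> L b" by metis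
  have L_mono: "L b \<le> L c" if "b \<in> B" "c \<in> B" "b \<le> c" for b c
    by (rule LIMSEQ_le[OF L[OF that(1)] L[OF that(2)]]) (use X that functionals_mono in blast)
  have L_add: "L b \<le> L c + L d" if "b \<in> B" "c \<in> B" "d \<in> B" "b \<le> c + d" for b c d
    by (rule LIMSEQ_le[OF L[OF that(1)] tendsto_add[OF L[OF that(2)] L[OF that(3)]]])
      (use X that functionals_mono functionals_add in metis)
  have L_add': "L c + L d \<le> L b" if "b \<in> B" "c \<in> B" "d \<in> B" "c + d \<le> b" for b c d
    by (rule LIMSEQ_le[OF tendsto_add[OF L[OF that(2)] L[OF that(3)]] L[OF that(1)]])
      (use X that functionals_mono functionals_add in metis)
  define l where "l a = (SUP b\<in>{b\<in>B. b \<lless> a}. L b)" for a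
  have l_ge: "L b \<le> l a" if "b \<in> B" "b \<lless> a" for a b
    unfolding l_def by (rule SUP_upper) (use that in auto)
  have l_le: "l a \<le> t" if "\<And>b. b \<in> B \<Longrightarrow> b \<lless> a \<Longrightarrow> L b \<le> t" for a t
    unfolding l_def by (rule SUP_least) (use that in auto)
  have l_less: "\<exists>b\<in>B. b \<lless> a \<and> t < L b" if "t < l a" for a t
    using that unfolding l_def less_SUP_iff by blast
  have "l \<in> functionals"
  proof (rule functionalsI)
    have "L b \<le> 0" if "b \<in> B" "b \<lless> 0" for b
    proof -
      have "b = 0" using way_below_imp_le[OF that(2)] zero_least by (rule antisym)
      then show ?thesis using L[OF that(1)] X
        by (simp add: functionals_zero tendsto_const_iff)
    qed
    then show "l 0 = 0" using l_le[of 0 0] by simp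
  next
    fix a b :: 'a assume "a \<le> b"
    then show "l a \<le> l b"
      by (intro l_le l_ge) (auto intro: way_below_le_trans)
  next
    fix a b :: 'a
    show "l (a + b) = l a + l b"
    proof (rule antisym)
      show "l (a + b) \<le> l a + l b"
      proof (rule l_le)
        fix x assume x: "x \<in> B" "x \<lless> a + b"
        obtain f where f: "\<And>n. f n \<le> f (Suc n)" "\<And>n. f n \<lless> a" "is_seq_sup f a"
          using way_below_approx by metis
        obtain g where g: "\<And>n. g n \<le> g (Suc n)" "\<And>n. g n \<lless> b" "is_seq_sup g b"
          using way_below_approx by metis
        \<comment> \<open>By (O4), \<open>x\<close> is absorbed at a finite stage, which leaves room
          for basis elements between that stage and \<open>a\<close>, \<open>b\<close>.\<close>
        have "is_seq_sup (\<lambda>n. f n + g n) (a + b)" using O4 f g by blast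
        then obtain n where n: "x \<le> f n + g n"
          using way_below_imp_seq[OF x(2), of "\<lambda>n. f n + g n"] f g add_mono by blast
        obtain c where c: "c \<in> B" "f n \<lless> c" "c \<lless> a" using basis_interpolation[OF f(2)] by metis
        obtain d where d: "d \<in> B" "g n \<lless> d" "d \<lless> b" using basis_interpolation[OF g(2)] by metis
        have "x \<le> c + d" using n c d way_below_imp_le add_mono order_trans by metis
        then have "L x \<le> L c + L d" using L_add x c d by blast
        also have "\<dots> \<le> l a + l b" using l_ge c d add_mono by blast
        finally show "L x \<le> l a + l b" .
      qed
      have "L c + L d \<le> l (a + b)" if cd: "c \<in> B" "c \<lless> a" "d \<in> B" "d \<lless> b" for c d
      proof -
        \<comment> \<open>(O3) gives \<open>c + d \<lless> a + b\<close>; since \<open>c + d\<close>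
          may lie outside the basis, a basis element is inserted to compare values of
          \<open>L\<close>.\<close>
        obtain x where x: "x \<in> B" "c + d \<lless> x" "x \<lless> a + b"
          using basis_interpolation[OF O3[OF cd(2) cd(4)]] by metis
        then have "L c + L d \<le> L x" using L_add' cd way_below_imp_le by blast
        then show ?thesis using l_ge x order_trans by blast
      qed
      moreover have "\<exists>c\<in>B. c \<lless> a" "\<exists>c\<in>B. c \<lless> b"
        using basis_interpolation[OF zero_way_below] by metis+
      ultimately have ne: "{c \<in> B. c \<lless> a} \<noteq> {}" "{c \<in> B. c \<lless> b} \<noteq> {}"
        and le: "\<And>c d. c \<in> {c \<in> B. c \<lless> a} \<Longrightarrow> d \<in> {c \<in> B. c \<lless> b} \<Longrightarrow> L c + L d \<le> l (a + b)"
        by blast+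
      show "l a + l b \<le> l (a + b)"
        unfolding l_def[of a] l_def[of b] ennreal_SUP_add_left[OF ne(1), symmetric]
          ennreal_SUP_add_right[OF ne(2)]
        by (intro SUP_least le)
    qed
  next
    fix f and s :: 'a assume f: "\<And>n. f n \<le> f (Suc n)" "is_seq_sup f s"
    show "l s \<le> (SUP n. l (f n))"
    proof (rule l_le)
      fix b assume b: "b \<in> B" "b \<lless> s"
      obtain c where c: "b \<lless> c" "c \<lless> s" using way_below_interpolation[OF b(2)] by blast
      obtain n where "c \<le> f n" using way_below_imp_seq[OF c(2) f] by blast
      then have "L b \<le> l (f n)" using l_ge b(1) c(1) way_below_le_trans by blast
      then show "L b \<le> (SUP n. l (f n))" by (rule order_trans[OF _ SUP_upper]) simp
    qed
  qed
  moreover have "functional_converges (X \<circ> r) l sequentially"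
    unfolding functional_converges_def
  proof (intro allI impI conjI)
    fix a' a :: 'a assume "a' \<lless> a"
    \<comment> \<open>At a basis element between \<open>a'\<close> and \<open>a\<close> the values
      converge, which bounds the limsup at \<open>a'\<close> by a value counted in
      \<open>l a\<close>.\<close>
    then obtain b where b: "b \<in> B" "a' \<lless> b" "b \<lless> a" using basis_interpolation by metis
    have "limsup (\<lambda>j. (X \<circ> r) j a') \<le> limsup (\<lambda>j. X (r j) b)"
      using functionals_mono[OF X way_below_imp_le[OF b(2)]] by (intro Limsup_mono) simp
    also have "\<dots> = L b" using L[OF b(1)] by (simp add: lim_imp_Limsup)
    finally show "limsup (\<lambda>j. (X \<circ> r) j a') \<le> l a" using l_ge b order_trans by blast
    show "l a \<le> liminf (\<lambda>j. (X \<circ> r) j a)"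
    proof (rule l_le)
      fix b assume b: "b \<in> B" "b \<lless> a"
      have "L b = liminf (\<lambda>j. X (r j) b)" using L[OF b(1)] by (simp add: lim_imp_Liminf)
      also have "\<dots> \<le> liminf (\<lambda>j. (X \<circ> r) j a)"
        using functionals_mono[OF X way_below_imp_le[OF b(2)]] by (intro Liminf_mono) simp
      finally show "L b \<le> liminf (\<lambda>j. (X \<circ> r) j a)" .
    qed
  qed
  ultimately show ?thesis using that r by blast
qed

end

section \<open>Compactness and order properties of the normalized functionals\<close>

locale normalized_cu = based_cu B for B :: "'a::cu_semigroup set" +
  fixes u :: 'a and K :: "('a \<Rightarrow> ennreal) set"
  assumes O5: "axiom_O5 TYPE('a)"
    and compact_u: "compact_element u"
    and full_u: "full_element u"
    and K_eq: "K = normalized_functionals u"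
begin

lemma complement:
  fixes a' a b' b c :: 'a
  assumes "a + b \<le> c" "a' \<lless> a" "b' \<lless> b"
  obtains x where "a' + x \<le> c" "c \<le> a + x" "b' \<lless> x"
  using O5 assms unfolding axiom_O5_def by blast

lemma K_functional: "l \<in> K \<Longrightarrow> l \<in> functionals"
  and K_unit: "l \<in> K \<Longrightarrow> l u = 1"
  by (auto simp: K_eq normalized_functionals_def)

lemmas K_mono = functionals_mono[OF K_functional]
  and K_add = functionals_add[OF K_functional]

lemma K_multiple: "l \<in> K \<Longrightarrow> l (\<Sum>i<n. u) = of_nat n"
  by (induction n) (auto simp: K_add K_unit functionals_zero[OF K_functional] add.commute)

text \<open>Fullness says that the multiples of \<open>u\<close> increase to the largest element,
  hence to something above \<open>b\<close>.\<close>

lemma way_below_multiple: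
  fixes a b :: 'a
  assumes "a \<lless> b"
  obtains n :: nat where "a \<le> (\<Sum>i<n. u)"
proof -
  obtain s where s: "is_seq_sup (\<lambda>n. \<Sum>i<n. u) s" "b \<le> s"
    using full_u unfolding full_element_def by blast
  have "(\<Sum>i<n. u) \<le> (\<Sum>i<Suc n. u)" for n :: nat
    using add_left_mono[OF zero_least, of "\<Sum>i<n. u" u] by simp
  then show ?thesis using way_below_imp_seq[OF assms _ s] that by blast
qed

text \<open>The bound is uniform on K because every normalized functional takes the value
  \<open>n\<close> at the \<open>n\<close>-th multiple of \<open>u\<close>.\<close>

lemma K_bounded:
  assumes "a \<lless> b"
  obtains n :: nat where "\<And>l. l \<in> K \<Longrightarrow> l a \<le> of_nat n"
  using way_below_multiple[OF assms] K_mono K_multiple by metis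

lemma K_finite:
  assumes "a \<lless> b" "l \<in> K"
  shows "l a < top"
proof -
  obtain n :: nat where "l a \<le> of_nat n" using K_bounded[OF assms(1)] assms(2) by metis
  then show ?thesis using of_nat_less_top by (rule order_le_less_trans)
qed

lemma K_seq_compact:
  fixes X :: "nat \<Rightarrow> 'a \<Rightarrow> ennreal"
  assumes X: "\<And>j. X j \<in> K"
  obtains r l where "strict_mono r" "l \<in> K" "functional_converges (X \<circ> r) l sequentially"
proof -
  obtain r l where r: "strict_mono r" "l \<in> functionals" "functional_converges (X \<circ> r) l sequentially"
    using functionals_seq_compact[of X] X K_functional by metis
  \<comment> \<open>Compactness \<open>u \<lless> u\<close> allows both bounds of convergence at
    \<open>u\<close> itself, so normalization survives in the limit.\<close>
  have "limsup (\<lambda>j. (X \<circ> r) j u) \<le> l u" "l u \<le> liminf (\<lambda>j. (X \<circ> r) j u)"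
    using r(3) compact_u unfolding functional_converges_def compact_element_def by blast+
  then have "l u = 1" using X by (simp add: K_unit Limsup_const Liminf_const)
  then show ?thesis using that r by (simp add: K_eq normalized_functionals_def)
qed

text \<open>Order complements inside multiples of \<open>u\<close> turn an inequality around, so that comparable
  normalized functionals are equal.\<close>

lemma K_antichain:
  assumes l: "l \<in> K" and m: "m \<in> K" and le: "\<And>a. l a \<le> m a"
  shows "l = m"
proof
  fix a
  have "m a \<le> l a"
  proof (rule dense_le)
    fix t assume "t < m a"
    then obtain b where b: "b \<lless> a" and t: "t < m b" using functionals_approx K_functional[OF m] by metis
    obtain d where d: "b \<lless> d" "d \<lless> a" using way_below_interpolation[OF b] by blast
    obtain n :: nat where n: "d \<le> (\<Sum>i<n. u)" using way_below_multiple[OF d(2)] by metis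
    obtain x where x: "b + x \<le> (\<Sum>i<n. u)" "(\<Sum>i<n. u) \<le> d + x"
      using complement[of d 0 "\<Sum>i<n. u" b 0] n d zero_way_below by auto
    have "m b + m x \<le> of_nat n" using K_mono[OF m x(1)] by (simp add: K_add m K_multiple)
    also have "of_nat n \<le> l d + l x" using K_mono[OF l x(2)] by (simp add: K_add l K_multiple)
    also have "\<dots> \<le> l d + m x" using le by (simp add: add_left_mono)
    finally have "m x + m b \<le> m x + l d" by (simp add: add.commute)
    moreover have "m x \<noteq> top" using \<open>m b + m x \<le> of_nat n\<close> by (auto simp: top_unique)
    ultimately have "m b \<le> l d" by (simp add: ennreal_add_left_cancel_le)
    also have "l d \<le> l a" using K_mono[OF l way_below_imp_le[OF d(2)]] .
    finally show "t \<le> l a" using t by simp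
  qed
  then show "l a = m a" using le by (simp add: antisym)
qed

section \<open>Common lower bounds\<close>

text \<open>The work takes place in some \<open>A \<lless> a\<close>, where functionals in K are
  finite. A complement \<open>q\<close> from (O5) turns \<open>p \<le> b + r\<close> into
  \<open>A \<le> b + (r + q)\<close>. Then (O6+), with \<open>y\<close> and 0 as the elements to be
  retained, splits \<open>A\<close>, and the finite value \<open>l q\<close> cancels.\<close>

lemma lower_bound_step:
  assumes O6: "axiom_O6_plus TYPE('a)"
    and x: "x \<lless> e" "e \<le> a" "e \<le> b" and p: "p' \<lless> p" "p \<lless> a" "p \<le> b + r"
  obtains e' where "x \<lless> e'" "e' \<le> a" "e' \<le> b" "\<And>l. l \<in> K \<Longrightarrow> l p' \<le> l e' + l r"
proof -
  obtain y where y: "x \<lless> y" "y \<lless> e" using way_below_interpolation[OF x(1)] by blast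
  have "y \<lless> a" using way_below_le_trans[OF order_refl y(2) x(2)] .
  then obtain A where A: "y \<le> A" "p \<le> A" "A \<lless> a" using way_below_directed p(2) by metis
  obtain q where q: "p' + q \<le> A" "A \<le> p + q"
    using complement[of p 0 A p' 0] A(2) p(1) zero_way_below by auto
  have "A \<le> b + (r + q)" using q(2) add_right_mono[OF p(3)] order_trans by (metis add.assoc)
  moreover have "y \<le> b" using way_below_imp_le[OF y(2)] x(3) by (rule order_trans)
  ultimately obtain e' f where ef: "A \<le> e' + f" "x \<lless> e'" "e' \<le> A" "e' \<le> b" "f \<le> r + q"
    using O6[unfolded axiom_O6_plus_def, rule_format, of A b "r + q" x y 0 0] y(1) A(1)
      zero_way_below zero_least by blast
  have "l p' \<le> l e' + l r" if l: "l \<in> K" for l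
  proof -
    have "l p' + l q \<le> l A" using K_mono[OF l q(1)] by (simp add: K_add l)
    also have "\<dots> \<le> l e' + l f" using K_mono[OF l ef(1)] by (simp add: K_add l)
    also have "\<dots> \<le> l e' + (l r + l q)" using K_mono[OF l ef(5)] by (simp add: K_add l add_left_mono)
    finally have "l q + l p' \<le> l q + (l e' + l r)" by (simp add: ac_simps)
    moreover have "l q \<noteq> top"
      using \<open>l p' + l q \<le> l A\<close> K_finite[OF A(3) l] by (auto simp: top_unique)
    ultimately show ?thesis by (simp add: ennreal_add_left_cancel_le)
  qed
  moreover have "e' \<le> a" using ef(3) way_below_imp_le[OF A(3)] by (rule order_trans)
  ultimately show ?thesis using that ef by blast
qed

text \<open>A Dini argument. If the late terms of a sequence increasing to \<open>e\<close> all
  failed somewhere on K, a limit \<open>l\<close> of the failing functionals would satisfy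
  \<open>l e + l r + \<epsilon> \<le> l p \<le> l e + l r\<close>, although \<open>l p\<close> is
  finite.\<close>

lemma uniform_way_below_approx:
  assumes p: "p' \<lless> p" "p \<lless> a" and e: "\<And>l. l \<in> K \<Longrightarrow> l p \<le> l e + l r"
    and x: "x \<lless> e" and \<epsilon>: "\<epsilon> > 0"
  obtains y where "x \<le> y" "y \<lless> e" "\<And>l. l \<in> K \<Longrightarrow> l p' \<le> l y + l r + \<epsilon>"
proof -
  obtain f where f: "\<And>n. f n \<le> f (Suc n)" "\<And>n. f n \<lless> e" "is_seq_sup f e"
    using way_below_approx by metis
  have "incseq f" using f(1) by (rule incseq_SucI)
  obtain N where N: "x \<le> f N" using way_below_imp_seq[OF x f(1,3) order_refl] by blast
  have "\<exists>n\<ge>N. \<forall>l\<in>K. l p' \<le> l (f n) + l r + \<epsilon>"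
  proof (rule ccontr)
    assume "\<not> ?thesis"
    then have "\<forall>n. \<exists>l. l \<in> K \<and> \<not> l p' \<le> l (f (N + n)) + l r + \<epsilon>"
      by (metis le_add1)
    then obtain X where X: "\<And>n. X n \<in> K" "\<And>n. X n (f (N + n)) + X n r + \<epsilon> < X n p'"
      by (metis not_le)
    obtain s l where s: "strict_mono s" "l \<in> K" and conv: "functional_converges (X \<circ> s) l sequentially"
      using K_seq_compact X(1) by metis
    have ev: "\<forall>\<^sub>F j in sequentially. v \<le> (X \<circ> s) j d" if "v = 0 \<or> v < l d" for v d
    proof (cases "v < l d")
      case True
      show ?thesis
        using functional_converges_liminf[OF conv True] by (rule eventually_mono) simp
    qed (use that in simp)
    \<comment> \<open>The left side passes to the limit through smaller test values
      \<open>v\<close>, \<open>w\<close> by lower semicontinuity; on the right,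
      \<open>p' \<lless> p\<close> bounds the limsup at \<open>p'\<close> by
      \<open>l p\<close>.\<close>
    have key: "l (f i) + (l r + \<epsilon>) \<le> l p" for i
    proof -
      have "v + w + \<epsilon> \<le> l p" if vw: "v = 0 \<or> v < l (f i)" "w = 0 \<or> w < l r" for v w
      proof -
        have "\<forall>\<^sub>F j in sequentially. v + w + \<epsilon> \<le> (X \<circ> s) j p'"
          using ev[OF vw(1)] ev[OF vw(2)] eventually_ge_at_top[of i]
        proof eventually_elim
          case (elim j)
          \<comment> \<open>The failing term \<open>f (N + s j)\<close> eventually dominates the
            fixed term \<open>f i\<close>.\<close>
          have "i \<le> N + s j" using elim(3) seq_suble[OF s(1), of j] by simp
          then have "v \<le> X (s j) (f (N + s j))"
            using elim(1) K_mono[OF X(1) incseqD[OF \<open>incseq f\<close>], of i "N + s j" "s j"] by simp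
          then have "v + w + \<epsilon> \<le> X (s j) (f (N + s j)) + X (s j) r + \<epsilon>"
            using elim(2) by (intro add_mono) auto
          also have "\<dots> < X (s j) p'" by (rule X(2))
          finally show ?case by simp
        qed
        then have "v + w + \<epsilon> \<le> limsup (\<lambda>j. (X \<circ> s) j p')"
          by (rule le_Limsup[rotated]) simp
        also have "\<dots> \<le> l p" using conv p(1) by (simp add: functional_converges_def)
        finally show ?thesis .
      qed
      then show ?thesis by (rule ennreal_add_leI_dense)
    qed
    have "l e + (l r + \<epsilon>) = (SUP i. l (f i) + (l r + \<epsilon>))"
      using functionals_SUP[OF K_functional[OF s(2)] f(1,3)] by (simp add: ennreal_SUP_add_left)
    also have "\<dots> \<le> l p" using key by (rule SUP_least)
    finally have le: "l e + (l r + \<epsilon>) \<le> l p" .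
    also have "\<dots> \<le> l e + l r" using e s(2) by blast
    finally have "l e + l r + \<epsilon> \<le> l e + l r + 0" by (simp add: add.assoc)
    moreover have "l e + (l r + \<epsilon>) < top" using le K_finite[OF p(2) s(2)] by (rule order_le_less_trans)
    then have "l e + l r \<noteq> top" by auto
    ultimately show False using \<epsilon> unfolding ennreal_add_left_cancel_le by simp
  qed
  then obtain n where "n \<ge> N" "\<And>l. l \<in> K \<Longrightarrow> l p' \<le> l (f n) + l r + \<epsilon>" by blast
  then show ?thesis using that[of "f n"] f(2) N incseqD[OF \<open>incseq f\<close>] order_trans by blast
qed

text \<open>Reduces an arbitrary \<open>s\<close> to countably many candidates: by (O4),
  \<open>b + f n\<close> increases to \<open>b + s\<close>, so \<open>p'\<close> is absorbed at a
  finite stage, and a basis element fits between \<open>f n\<close> and \<open>s\<close>.\<close>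

lemma basis_complement:
  fixes p b s :: 'a
  assumes "p' \<lless> p" "p \<le> b + s"
  obtains r where "r \<in> B" "r \<le> s" "p' \<le> b + r"
proof -
  obtain f where f: "\<And>n. f n \<le> f (Suc n)" "\<And>n. f n \<lless> s" "is_seq_sup f s"
    using way_below_approx by metis
  have "is_seq_sup (\<lambda>n. b) b" by (simp add: is_seq_sup_def)
  then have "is_seq_sup (\<lambda>n. b + f n) (b + s)" using O4[of "\<lambda>n. b" f b s] f by simp
  then obtain n where n: "p' \<le> b + f n"
    using way_below_imp_seq[OF assms(1), of "\<lambda>n. b + f n"] f(1) assms(2) add_left_mono by blast
  obtain r where r: "r \<in> B" "f n \<lless> r" "r \<lless> s" using basis_interpolation[OF f(2)] by metis
  have "p' \<le> b + r" using n add_left_mono[OF way_below_imp_le[OF r(2)]] by (rule order_trans)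
  then show ?thesis using that r way_below_imp_le by blast
qed

lemma large_lower_bound:
  assumes O6: "axiom_O6_plus TYPE('a)"
  obtains c where "c \<le> a" "c \<le> b"
    "\<And>p s l. p \<le> a \<Longrightarrow> p \<le> b + s \<Longrightarrow> l \<in> K \<Longrightarrow> l p \<le> l c + l s"
proof -
  \<comment> \<open>Every basis constraint \<open>(p', p, r)\<close> is listed with every tolerance
    \<open>1 / Suc k\<close>. A constraint once met remains met, because the sequence
    \<open>x\<close> built below increases.\<close>
  define T where "T = from_nat_into (B \<times> B \<times> B \<times> (UNIV :: nat set))"
  define Q where "Q = (\<lambda>(p', p, r, k) y.
    p' \<lless> p \<and> p \<lless> a \<and> p \<le> b + r \<longrightarrow> (\<forall>l\<in>K. l p' \<le> l y + l r + ennreal (1 / Suc k)))"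
  \<comment> \<open>The invariant asks for more than a common lower bound: (O6+) retains only what
    is way below the current bound \<open>e\<close>.\<close>
  define P where "P x \<longleftrightarrow> (\<exists>e. x \<lless> e \<and> e \<le> a \<and> e \<le> b)" for x
  have step: "\<exists>y. P y \<and> x \<le> y \<and> Q t y" if "P x" for x t
  proof -
    obtain p' p r k where t: "t = (p', p, r, k)" by (cases t)
    show ?thesis
    proof (cases "p' \<lless> p \<and> p \<lless> a \<and> p \<le> b + r")
      case True
      obtain q where q: "p' \<lless> q" "q \<lless> p" using way_below_interpolation True by blast
      obtain e where e: "x \<lless> e" "e \<le> a" "e \<le> b" using \<open>P x\<close> by (auto simp: P_def)
      obtain e' where e': "x \<lless> e'" "e' \<le> a" "e' \<le> b" "\<And>l. l \<in> K \<Longrightarrow> l q \<le> l e' + l r"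
        using lower_bound_step[OF O6 e q(2)] True by metis
      obtain y where "x \<le> y" "y \<lless> e'" "\<And>l. l \<in> K \<Longrightarrow> l p' \<le> l y + l r + ennreal (1 / Suc k)"
        using uniform_way_below_approx[OF q e'(4,1), of "ennreal (1 / Suc k)"] by auto
      then show ?thesis using e' by (auto simp: P_def Q_def t)
    next
      case False
      then show ?thesis using \<open>P x\<close> by (auto simp: Q_def t)
    qed
  qed
  have "P 0" using zero_way_below zero_least by (auto simp: P_def)
  then have "\<exists>x. \<forall>n. P (x n) \<and> x n \<le> x (Suc n) \<and> Q (T n) (x (Suc n))"
    using step by (intro dependent_nat_choice) auto
  then obtain x where x: "\<And>n. P (x n)" "\<And>n. x n \<le> x (Suc n)" "\<And>n. Q (T n) (x (Suc n))"
    by blast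
  obtain c where c: "is_seq_sup x c" using O1[of x] x(2) by blast
  have xab: "x n \<le> a" "x n \<le> b" for n
    using x(1)[of n] way_below_imp_le order_trans unfolding P_def by metis+
  have basic: "l p' \<le> l c + l r"
    if "p' \<in> B" "p \<in> B" "r \<in> B" "p' \<lless> p" "p \<lless> a" "p \<le> b + r" "l \<in> K" for p' p r l
  proof (rule ennreal_le_epsilon)
    fix \<epsilon> :: real assume "0 < \<epsilon>"
    then obtain k where k: "1 / Suc k < \<epsilon>" using nat_approx_posE by metis
    have "countable (B \<times> B \<times> B \<times> (UNIV :: nat set))" using countable_B by simp
    moreover have "(p', p, r, k) \<in> B \<times> B \<times> B \<times> UNIV" using that by blast
    ultimately obtain n where "T n = (p', p, r, k)"
      unfolding T_def using from_nat_into_surj by metis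
    then have "l p' \<le> l (x (Suc n)) + l r + ennreal (1 / Suc k)"
      using x(3)[of n] that by (simp add: Q_def)
    also have "\<dots> \<le> l c + l r + ennreal \<epsilon>"
      using K_mono[OF \<open>l \<in> K\<close>, of "x (Suc n)" c] c k
      by (intro add_mono ennreal_leI) (auto simp: is_seq_sup_def)
    finally show "l p' \<le> l c + l r + ennreal \<epsilon>" .
  qed
  have "l p \<le> l c + l s" if p: "p \<le> a" "p \<le> b + s" and l: "l \<in> K" for p s l
  proof (rule dense_le)
    fix t assume "t < l p"
    then obtain q where q: "q \<lless> p" "t < l q" using functionals_approx[OF K_functional[OF l]] by metis
    \<comment> \<open>The chain \<open>q \<lless> q1 \<lless> q2 \<lless> p\<close> supplies the
      basis pair for \<open>basic\<close>; the last gap pays for replacing \<open>s\<close> by a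
      basis element \<open>r\<close>.\<close>
    obtain q2 where q2: "q2 \<in> B" "q \<lless> q2" "q2 \<lless> p" using basis_interpolation[OF q(1)] by metis
    obtain q1 where q1: "q1 \<in> B" "q \<lless> q1" "q1 \<lless> q2" using basis_interpolation[OF q2(2)] by metis
    obtain r where r: "r \<in> B" "r \<le> s" "q2 \<le> b + r" using basis_complement[OF q2(3) p(2)] by metis
    have "q2 \<lless> a" using way_below_le_trans[OF order_refl q2(3) p(1)] .
    have "t < l q" by fact
    also have "l q \<le> l q1" using K_mono[OF l way_below_imp_le[OF q1(2)]] .
    also have "\<dots> \<le> l c + l r" using basic[OF q1(1) q2(1) r(1) q1(3) \<open>q2 \<lless> a\<close> r(3) l] .
    also have "\<dots> \<le> l c + l s" using K_mono[OF l r(2)] by (rule add_left_mono)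
    finally show "t \<le> l c + l s" by simp
  qed
  moreover have "c \<le> a" "c \<le> b" using c xab by (auto simp: is_seq_sup_def)
  ultimately show ?thesis using that by blast
qed

text \<open>Complementing a lower bound of \<open>p\<close> and \<open>b\<close> provided by Edwards' condition yields
  the elements \<open>s\<close> for which \<open>large_lower_bound\<close> is sharp at \<open>l\<close>. Passing
  to \<open>p \<lless> a\<close> makes \<open>l p\<close> finite.\<close>

lemma edwards_lower_bound:
  assumes ed: "edwards_condition E" and l: "l \<in> E" "l \<in> K"
    and c: "\<And>p s. p \<le> a \<Longrightarrow> p \<le> b + s \<Longrightarrow> l p \<le> l c + l s"
  shows "min (l a) (l b) \<le> l c"
proof (rule dense_le)
  fix t assume t: "t < min (l a) (l b)"
  then obtain p where p: "p \<lless> a" "t < l p" using functionals_approx[OF K_functional[OF l(2)]] by auto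
  have "min (l p) (l b) = Sup {l g | g. g \<le> p \<and> g \<le> b}"
    using ed l(1) unfolding edwards_condition_def by blast
  then have "t < Sup {l g | g. g \<le> p \<and> g \<le> b}" using p(2) t by (metis min_less_iff_conj)
  then obtain g where g: "g \<le> p" "g \<le> b" "t < l g" by (auto simp: less_Sup_iff)
  obtain g' where g': "g' \<lless> g" "t < l g'" using functionals_approx[OF K_functional[OF l(2)] g(3)] .
  obtain s where s: "g' + s \<le> p" "p \<le> g + s"
    using complement[of g 0 p g' 0] g(1) g'(1) zero_way_below by auto
  have "p \<le> b + s" using s(2) add_right_mono[OF g(2)] by (rule order_trans)
  then have "l p \<le> l c + l s" using c way_below_imp_le[OF p(1)] by blast
  moreover have "l g' + l s \<le> l p" using K_mono[OF l(2) s(1)] by (simp add: K_add l(2))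
  ultimately have "l g' + l s \<le> l c + l s" by (rule order_trans[rotated])
  then have "l s + l g' \<le> l s + l c" by (simp add: add.commute)
  moreover have "l g' + l s < top"
    using \<open>l g' + l s \<le> l p\<close> K_finite[OF p(1) l(2)] by (rule order_le_less_trans)
  then have "l s \<noteq> top" by auto
  ultimately have "l g' \<le> l c" unfolding ennreal_add_left_cancel_le by simp
  then show "t \<le> l c" using g'(2) by simp
qed

section \<open>Lower semicontinuous functions and extreme points\<close>

lemma convex_comb_K:
  assumes l: "l \<in> K" and m: "m \<in> K" and t: "0 \<le> t" "t \<le> 1"
  shows "convex_comb t l m \<in> K"
proof -
  have "convex_comb t l m \<in> functionals"
  proof (rule functionalsI)
    fix f s assume f: "\<And>n. f n \<le> f (Suc n)" "is_seq_sup f (s :: 'a)"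
    have "incseq f" using f(1) by (rule incseq_SucI)
    then have "convex_comb t l m s = (SUP n. ennreal t * l (f n) + ennreal (1 - t) * m (f n))"
      unfolding convex_comb_def functionals_SUP[OF K_functional[OF l] f] functionals_SUP[OF K_functional[OF m] f]
        SUP_mult_left_ennreal
      by (intro ennreal_SUP_add[symmetric])
        (auto intro!: mult_left_mono K_mono[OF l] K_mono[OF m] simp: mono_def)
    then show "convex_comb t l m s \<le> (SUP n. convex_comb t l m (f n))"
      by (simp add: convex_comb_def)
  next
    fix a b :: 'a assume "a \<le> b"
    then show "convex_comb t l m a \<le> convex_comb t l m b"
      unfolding convex_comb_def by (intro add_mono mult_left_mono K_mono[OF l] K_mono[OF m]) simp_all
  qed (simp_all add: convex_comb_def K_add l m functionals_zero[OF K_functional] distrib_left ac_simps)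
  moreover have "ennreal t + ennreal (1 - t) = 1"
    using t by (simp flip: ennreal_plus)
  ultimately show ?thesis
    using t by (simp add: K_eq normalized_functionals_def convex_comb_def K_unit[OF l] K_unit[OF m])
qed

lemma hat_convex_comb:
  assumes "0 \<le> t" "t \<le> 1"
  shows "hat a (convex_comb t l m) = ereal t * hat a l + ereal (1 - t) * hat a m"
  using assms by (simp add: hat_def convex_comb_def plus_ennreal.rep_eq times_ennreal.rep_eq)

section \<open>Minimizing lower semicontinuous concave functions over closed faces\<close>

definition seq_lsc :: "(('a \<Rightarrow> ennreal) \<Rightarrow> ereal) \<Rightarrow> bool" where
  "seq_lsc G \<longleftrightarrow> (\<forall>X l r. (\<forall>j. X j \<in> K) \<and> l \<in> K \<and> functional_converges X l sequentially \<and>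
     ereal r < G l \<longrightarrow> (\<forall>\<^sub>F j in sequentially. ereal r < G (X j)))"

text \<open>Excluding the value -\<infinity> keeps the convex combinations free of sums of opposite
  infinities.\<close>

definition concave_fun :: "(('a \<Rightarrow> ennreal) \<Rightarrow> ereal) \<Rightarrow> bool" where
  "concave_fun G \<longleftrightarrow> (\<forall>l\<in>K. G l \<noteq> - \<infinity>) \<and> (\<forall>l\<in>K. \<forall>m\<in>K. \<forall>t. 0 < t \<and> t < 1 \<longrightarrow>
     ereal t * G l + ereal (1 - t) * G m \<le> G (convex_comb t l m))"

definition closed_face :: "('a \<Rightarrow> ennreal) set \<Rightarrow> bool" where
  "closed_face F \<longleftrightarrow> F \<subseteq> K \<and> F \<noteq> {} \<and>
     (\<forall>X l. (\<forall>j. X j \<in> F) \<and> l \<in> K \<and> functional_converges X l sequentially \<longrightarrow> l \<in> F) \<and>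
     (\<forall>l\<in>K. \<forall>m\<in>K. \<forall>t. 0 < t \<and> t < 1 \<and> convex_comb t l m \<in> F \<longrightarrow> l \<in> F \<and> m \<in> F)"

definition argmin_on :: "('a \<Rightarrow> ennreal) set \<Rightarrow> (('a \<Rightarrow> ennreal) \<Rightarrow> ereal) \<Rightarrow> ('a \<Rightarrow> ennreal) set" where
  "argmin_on F G = {l \<in> F. \<forall>m\<in>F. G l \<le> G m}"

lemma closed_faceI:
  assumes "F \<subseteq> K" "F \<noteq> {}"
    and "\<And>X l. (\<And>j. X j \<in> F) \<Longrightarrow> l \<in> K \<Longrightarrow> functional_converges X l sequentially \<Longrightarrow> l \<in> F"
    and "\<And>l m t. l \<in> K \<Longrightarrow> m \<in> K \<Longrightarrow> 0 < t \<Longrightarrow> t < 1 \<Longrightarrow> convex_comb t l m \<in> F \<Longrightarrow> l \<in> F \<and> m \<in> F"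
  shows "closed_face F"
  unfolding closed_face_def
proof (intro conjI allI ballI impI)
  show "l \<in> F" if "(\<forall>j. X j \<in> F) \<and> l \<in> K \<and> functional_converges X l sequentially" for X l
    using assms(3)[of X l] that by simp
  show "l \<in> F" "m \<in> F" if "l \<in> K" "m \<in> K" "0 < t \<and> t < 1 \<and> convex_comb t l m \<in> F" for l m t
    using assms(4)[of l m t] that by simp_all
qed (use assms in simp_all)

lemma closed_faceD:
  assumes F: "closed_face F"
  shows "F \<subseteq> K" "F \<noteq> {}"
    and "\<And>X l. (\<And>j. X j \<in> F) \<Longrightarrow> l \<in> K \<Longrightarrow> functional_converges X l sequentially \<Longrightarrow> l \<in> F"
    and "\<And>l m t. l \<in> K \<Longrightarrow> m \<in> K \<Longrightarrow> 0 < t \<Longrightarrow> t < 1 \<Longrightarrow> convex_comb t l m \<in> F \<Longrightarrow> l \<in> F \<and> m \<in> F"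
proof -
  note * = F[unfolded closed_face_def]
  show "F \<subseteq> K" "F \<noteq> {}" using * by simp_all
  show "l \<in> F" if "\<And>j. X j \<in> F" "l \<in> K" "functional_converges X l sequentially" for X l
    using *[THEN conjunct2, THEN conjunct2, THEN conjunct1, rule_format, of X l] that by simp
  show "l \<in> F \<and> m \<in> F" if "l \<in> K" "m \<in> K" "0 < t" "t < 1" "convex_comb t l m \<in> F" for l m t
    using *[THEN conjunct2, THEN conjunct2, THEN conjunct2, rule_format, of l m t] that by simp
qed

lemma seq_lscD:
  fixes X :: "nat \<Rightarrow> 'a \<Rightarrow> ennreal"
  assumes G: "seq_lsc G" and "\<And>j. X j \<in> K" "l \<in> K" "functional_converges X l sequentially" "ereal r < G l"
  shows "\<forall>\<^sub>F j in sequentially. ereal r < G (X j)"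
  using G[unfolded seq_lsc_def, rule_format, of X l r] assms(2-) by simp

lemma seq_lsc_hat: "seq_lsc (hat a)"
  unfolding seq_lsc_def
proof (intro allI impI, elim conjE)
  fix X l r
  assume conv: "functional_converges X l sequentially" and r: "ereal r < hat a l"
  show "\<forall>\<^sub>F j in sequentially. ereal r < hat a (X j)"
  \<comment> \<open>\<open>ennreal\<close> truncates negative reals to 0, so the translation of the
    inequality is valid for nonnegative \<open>r\<close>; below 0 the claim is trivial.\<close>
  proof (cases "r < 0")
    case True
    then show ?thesis by (auto simp: hat_def intro!: always_eventually less_le_trans[OF _ enn2ereal_nonneg])
  next
    case False
    have eq: "ereal r < hat a m \<longleftrightarrow> ennreal r < m a" for m :: "'a \<Rightarrow> ennreal"
      using False by (simp add: hat_def less_ennreal.rep_eq)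
    show ?thesis using functional_converges_liminf[OF conv] r by (simp add: eq)
  qed
qed

lemma concave_hat: "concave_fun (hat a)"
proof -
  have "hat a l \<noteq> - \<infinity>" for l
    using enn2ereal_nonneg[of "l a"] by (auto simp: hat_def)
  then show ?thesis by (auto simp: concave_fun_def hat_convex_comb)
qed

text \<open>The direct method: a minimizing sequence subconverges inside the closed face, and lower
  semicontinuity bounds the value at the limit by the infimum.\<close>

lemma attains_min:
  assumes F: "closed_face F" and G: "seq_lsc G"
  shows "\<exists>l\<in>F. \<forall>m\<in>F. G l \<le> G m"
proof -
  have FK: "F \<subseteq> K" "F \<noteq> {}" using F by (auto simp: closed_face_def)
  define i where "i = Inf (G ` F)"
  obtain U where U: "\<And>n. U n \<in> G ` F" "U \<longlonglongrightarrow> i"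
    using Inf_as_limit[of "G ` F"] FK unfolding i_def by auto
  then have "\<forall>n. \<exists>l. l \<in> F \<and> U n = G l" by blast
  then obtain X where X: "\<And>n. X n \<in> F" "\<And>n. U n = G (X n)" by metis
  have XK: "X n \<in> K" for n using X(1) FK(1) by blast
  obtain s l where s: "strict_mono s" "l \<in> K" "functional_converges (X \<circ> s) l sequentially"
    using K_seq_compact[of X, OF XK] .
  have "(X \<circ> s) j \<in> F" for j using X(1) by simp
  then have lF: "l \<in> F" using closed_faceD(3)[OF F _ s(2,3)] by blast
  have "G l \<le> i"
  proof (rule ccontr)
    assume "\<not> G l \<le> i"
    then have "i < G l" by simp
    then obtain r where r: "i < ereal r" "ereal r < G l" using ereal_dense2 by blast
    have "\<forall>\<^sub>F j in sequentially. ereal r < G ((X \<circ> s) j)"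
      by (rule seq_lscD[OF G _ s(2,3) r(2)]) (use X FK in auto)
    moreover have "(U \<circ> s) \<longlonglongrightarrow> i" using U(2) s(1) by (rule LIMSEQ_subseq_LIMSEQ)
    then have "\<forall>\<^sub>F j in sequentially. G ((X \<circ> s) j) < ereal r"
      using order_tendstoD(2)[OF _ r(1)] by (simp add: X(2) o_def)
    ultimately have "\<forall>\<^sub>F j in sequentially. False" by eventually_elim auto
    then show False by simp
  qed
  then have "G l \<le> G m" if "m \<in> F" for m
    using INF_lower[OF that, of G] order_trans unfolding i_def by blast
  then show ?thesis using lF by blast
qed

text \<open>Lower semicontinuity gives closedness. For the face property, a concave function that is
  minimal at an interior point of a segment is minimal at both endpoints.\<close>

lemma closed_face_argmin:
  assumes F: "closed_face F" and G: "seq_lsc G" "concave_fun G"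
  shows "closed_face (argmin_on F G)"
proof (rule closed_faceI)
  have FK: "F \<subseteq> K" by (rule closed_faceD(1)[OF F])
  then show "argmin_on F G \<subseteq> K" by (auto simp: argmin_on_def)
  show "argmin_on F G \<noteq> {}" using attains_min[OF F G(1)] by (auto simp: argmin_on_def)
  show "l \<in> argmin_on F G"
    if X: "\<And>j. X j \<in> argmin_on F G" and l: "l \<in> K" "functional_converges X l sequentially" for X l
  proof -
    have XF: "X j \<in> F" for j using X by (auto simp: argmin_on_def)
    have lF: "l \<in> F" using closed_faceD(3)[OF F XF l] .
    have "G l \<le> G m" if m: "m \<in> F" for m
    proof (rule ccontr)
      assume "\<not> G l \<le> G m"
      then have "G m < G l" by simp
      then obtain r where r: "G m < ereal r" "ereal r < G l" using ereal_dense2 by blast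
      have "\<forall>\<^sub>F j in sequentially. ereal r < G (X j)"
        by (rule seq_lscD[OF G(1) _ l r(2)]) (use XF FK in auto)
      moreover have "G (X j) < ereal r" for j
        using X[of j] m r(1) by (auto simp: argmin_on_def intro: order_le_less_trans)
      ultimately show False by (auto simp: eventually_sequentially dest: order_less_asym)
    qed
    then show ?thesis using lF by (simp add: argmin_on_def)
  qed
  show "l \<in> argmin_on F G \<and> m \<in> argmin_on F G"
    if lm: "l \<in> K" "m \<in> K" and t: "0 < t" "t < 1" and c: "convex_comb t l m \<in> argmin_on F G" for l m t
  proof -
    let ?c = "convex_comb t l m"
    have "?c \<in> F" and cmin: "\<And>n. n \<in> F \<Longrightarrow> G ?c \<le> G n" using c by (auto simp: argmin_on_def)
    then have F': "l \<in> F" "m \<in> F" using closed_faceD(4)[OF F lm t] by auto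
    have "ereal t * G l + ereal (1 - t) * G m \<le> G ?c"
      and "G l \<noteq> - \<infinity>" "G m \<noteq> - \<infinity>" using G(2) lm t by (auto simp: concave_fun_def)
    moreover have "G ?c \<le> G l" "G ?c \<le> G m" using cmin F' by auto
    ultimately have "G l = G ?c \<and> G m = G ?c"
      using t by (intro ereal_convex_combination_eq)
    then show ?thesis using F' cmin by (auto simp: argmin_on_def)
  qed
qed

text \<open>Bauer's minimum principle. The extreme point is found by minimising \<open>G\<close> first and then, one
  after the other, the evaluations at all elements of the basis.\<close>

lemma bauer_minimum:
  assumes G: "seq_lsc G" "concave_fun G" and l0: "l0 \<in> K"
  obtains l where "l \<in> extreme_boundary K" "G l \<le> G l0"
proof -
  define e where "e = from_nat_into B"
  define F where "F = rec_nat (argmin_on K G) (\<lambda>n F. argmin_on F (hat (e n)))"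
  have F0: "F 0 = argmin_on K G" and FS: "F (Suc n) = argmin_on (F n) (hat (e n))" for n
    by (simp_all add: F_def)
  have "closed_face K" using l0 by (auto simp: closed_face_def)
  then have face: "closed_face (F n)" for n
    by (induction n) (auto simp: F0 FS intro!: closed_face_argmin G seq_lsc_hat concave_hat)
  have "F (Suc n) \<subseteq> F n" for n by (auto simp: FS argmin_on_def)
  then have dec: "F n \<subseteq> F m" if "m \<le> n" for m n
    using lift_Suc_antimono_le[of F m n] that by blast
  have FK: "F n \<subseteq> K" for n using face by (auto simp: closed_face_def)
  have "\<forall>n. \<exists>l. l \<in> F n" using closed_faceD(2)[OF face] by blast
  then obtain X where X: "\<And>n. X n \<in> F n" by metis
  then have XK: "X n \<in> K" for n using FK by blast
  obtain s l where s: "strict_mono s" "l \<in> K" "functional_converges (X \<circ> s) l sequentially"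
    using K_seq_compact[of X, OF XK] .
  have lF: "l \<in> F n" for n
  proof -
    \<comment> \<open>From index \<open>n\<close> on, the subsequence stays in \<open>F n\<close>,
      which is closed.\<close>
    have "strict_mono ((+) n)" by (simp add: strict_mono_def)
    then have "functional_converges (X \<circ> s \<circ> (+) n) l sequentially"
      using functional_converges_subseq s(3) by blast
    moreover have "(X \<circ> s \<circ> (+) n) j \<in> F n" for j
      using X[of "s (n + j)"] dec[of n "s (n + j)"] seq_suble[OF s(1), of "n + j"] by auto
    ultimately show ?thesis using closed_faceD(3)[OF face[of n] _ s(2)] by blast
  qed
  \<comment> \<open>The faces meet in one point: two common points both minimize each evaluation
    \<open>hat (e k)\<close> over \<open>F k\<close>, hence agree on the basis.\<close>
  have eq: "m = n" if m: "\<And>k. m \<in> F k" and n: "\<And>k. n \<in> F k" for m n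
  proof -
    have "m b = n b" if "b \<in> B" for b
    proof -
      obtain k where k: "e k = b" using from_nat_into_surj[OF countable_B \<open>b \<in> B\<close>] by (auto simp: e_def)
      have "hat b m = hat b n"
        using m[of "Suc k"] n[of "Suc k"] by (auto simp: FS argmin_on_def k intro: antisym)
      then show ?thesis by (simp add: hat_def enn2ereal_inject)
    qed
    moreover have "m \<in> functionals" "n \<in> functionals" using m n FK K_functional by blast+
    ultimately have "m a = n a" for a
      using functionals_le_basis[of m n a] functionals_le_basis[of n m a] by (simp add: antisym)
    then show ?thesis by blast
  qed
  have "l \<in> extreme_boundary K"
    unfolding extreme_boundary_def
  proof (safe, fact s(2))
    \<comment> \<open>The endpoints of a segment through \<open>l\<close> lie in every face
      \<open>F k\<close>, so they coincide with \<open>l\<close>.\<close>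
    fix m n t assume mn: "m \<in> K" "n \<in> K" "0 < t" "t < 1" "l = convex_comb t m n"
    then have "m \<in> F k \<and> n \<in> F k" for k
      using closed_faceD(4)[OF face[of k]] lF[of k] by simp
    then show "m = convex_comb t m n" "n = convex_comb t m n" using eq lF mn(5) by blast+
  qed
  moreover have "G l \<le> G l0" using lF[of 0] l0 by (simp add: F0 argmin_on_def)
  ultimately show ?thesis using that by blast
qed

section \<open>Elements of \<open>LAff K\<close> and their comparison on the extreme
  boundary\<close>

lemma hat_LAff: "restrict (hat a) K \<in> LAff K"
proof -
  have "openin functional_topology {l \<in> functionals. r < hat a l}" for r
    unfolding openin_functional_topology
  proof (intro conjI ballI allI impI)
    fix l F
    assume l: "l \<in> {l \<in> functionals. r < hat a l}"
      and F: "F \<le> principal functionals \<and> functional_converges (\<lambda>m. m) l F"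
    have "\<forall>\<^sub>F m in F. r < hat a m"
    proof (cases "r < 0")
      case True
      then show ?thesis by (auto simp: hat_def intro!: always_eventually less_le_trans[OF _ enn2ereal_nonneg])
    next
      case False
      have eq: "r < hat a m \<longleftrightarrow> e2ennreal r < m a" for m :: "'a \<Rightarrow> ennreal"
        using False by (simp add: hat_def less_ennreal.rep_eq enn2ereal_e2ennreal)
      show ?thesis using functional_converges_liminf[of "\<lambda>m. m" l F "e2ennreal r" a] F l by (simp add: eq)
    qed
    moreover have "\<forall>\<^sub>F m in F. m \<in> functionals" using F by (simp add: le_principal)
    ultimately show "\<forall>\<^sub>F m in F. m \<in> {l \<in> functionals. r < hat a l}"
      by eventually_elim simp
  qed auto
  then have "openin (subtopology functional_topology K) ({l \<in> functionals. r < hat a l} \<inter> K)" for r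
    by (rule openin_subtopology_Int)
  moreover have "{l \<in> functionals. r < hat a l} \<inter> K = {l \<in> K. r < restrict (hat a) K l}" for r
    using K_functional by auto
  moreover have "- \<infinity> < hat a l" for l
    by (simp add: hat_def less_le_trans[OF _ enn2ereal_nonneg])
  ultimately show ?thesis
    by (auto simp: LAff_def convex_comb_K hat_convex_comb)
qed

lemma LAff_seq_lsc:
  assumes "k \<in> LAff K"
  shows "seq_lsc k"
  unfolding seq_lsc_def
proof (intro allI impI, elim conjE)
  fix X l r
  assume X: "\<forall>j. X j \<in> K" and l: "l \<in> K" and conv: "functional_converges X l sequentially"
    and r: "ereal r < k l"
  obtain U where U: "openin functional_topology U" "{l \<in> K. ereal r < k l} = U \<inter> K"
    using assms unfolding LAff_def openin_subtopology by blast
  have "limitin functional_topology X l sequentially"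
    using limitin_functional_topology[of X l] X l conv K_functional by blast
  moreover have "l \<in> U" using U(2) l r by blast
  ultimately have "\<forall>\<^sub>F j in sequentially. X j \<in> U" using U(1) by (simp add: limitin_def)
  then show "\<forall>\<^sub>F j in sequentially. ereal r < k (X j)"
    by (rule eventually_mono) (use U(2) X in blast)
qed

lemma closed_face_K: "l \<in> K \<Longrightarrow> closed_face K"
  by (rule closed_faceI) auto

text \<open>The minorants are inf-convolutions of \<open>k\<close> with
  \<open>N * (\<Sum>n<N. max 0 (l (q n) - m (q n)))\<close>, where \<open>q\<close> enumerates basis elements. This penalty is
  upper semicontinuous in \<open>m\<close> although \<open>k\<close> is only lower semicontinuous, and
  it separates points because comparable normalized functionals are equal.\<close>

lemma LAff_usc_minorant:
  assumes k: "k \<in> LAff K" and l0: "l0 \<in> K" and t: "ereal t < k l0"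
  obtains \<phi> :: "('a \<Rightarrow> ennreal) \<Rightarrow> real" where "t < \<phi> l0" "\<forall>l\<in>K. ereal (\<phi> l) \<le> k l"
    "concave_fun (\<lambda>l. - ereal (\<phi> l))" "seq_lsc (\<lambda>l. - ereal (\<phi> l))"
proof -
  define D where "D = {l \<in> K. k l < \<infinity>}"
  show ?thesis
  proof (cases "D = {}")
    case True
    then have "k l = \<infinity>" if "l \<in> K" for l using that by (auto simp: D_def)
    then show ?thesis
      by (intro that[of "\<lambda>_. t + 1"]) (auto simp: concave_fun_def seq_lsc_def algebra_simps)
  next
    case ne: False
    have DK: "D \<subseteq> K" by (auto simp: D_def)
    define \<kappa> where "\<kappa> l = real_of_ereal (k l)" for l
    have kinf: "- \<infinity> < k l" if "l \<in> K" for l using k that by (auto simp: LAff_def)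
    have \<kappa>: "k l = ereal (\<kappa> l)" if "l \<in> D" for l
      using that kinf[of l] by (cases "k l") (auto simp: D_def \<kappa>_def)
    \<comment> \<open>The minimum of \<open>k\<close> is finite since \<open>D\<close> is nonempty;
      it keeps the infima defining \<open>\<phi>\<close> bounded below.\<close>
    obtain lm where lm: "lm \<in> K" "\<And>l. l \<in> K \<Longrightarrow> k lm \<le> k l"
      using attains_min[OF closed_face_K[OF l0] LAff_seq_lsc[OF k]] by blast
    then have "lm \<in> D" using ne by (fastforce simp: D_def)
    define M where "M = \<kappa> lm"
    have M: "M \<le> \<kappa> l" if "l \<in> D" for l
      using lm(2)[of l] that DK \<kappa>[OF that] \<kappa>[OF \<open>lm \<in> D\<close>] by (auto simp: M_def)
    \<comment> \<open>Basis elements way below something have finite values on K, so passing to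
      reals loses nothing, and they determine functionals.\<close>
    define Bf where "Bf = {b \<in> B. \<exists>a. b \<lless> a}"
    obtain b where "b \<in> B" "b \<lless> u" using basis_interpolation[OF zero_way_below[of u]] by metis
    then have "Bf \<noteq> {}" by (auto simp: Bf_def)
    define q where "q = from_nat_into Bf"
    have q_range: "\<exists>n. q n = b" if "b \<in> Bf" for b
    proof -
      have "countable Bf" using countable_B by (auto simp: Bf_def)
      then show ?thesis using from_nat_into_surj that by (metis q_def)
    qed
    have q_in: "q n \<in> Bf" for n using from_nat_into[OF \<open>Bf \<noteq> {}\<close>] by (simp add: q_def)
    define v where "v l n = enn2real (l (q n))" for l :: "'a \<Rightarrow> ennreal" and n
    have v: "l (q n) = ennreal (v l n)" if "l \<in> K" for l n
      using K_finite[of "q n" _ l] q_in[of n] that by (auto simp: v_def Bf_def)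
    have v0: "0 \<le> v l n" for l n by (simp add: v_def)
    have v_comb: "v (convex_comb s l m) n = s * v l n + (1 - s) * v m n"
      if "l \<in> K" "m \<in> K" "0 < s" "s < 1" for l m s n
    proof -
      have "convex_comb s l m (q n) = ennreal s * ennreal (v l n) + ennreal (1 - s) * ennreal (v m n)"
        by (simp only: convex_comb_def v that(1,2))
      also have "\<dots> = ennreal (s * v l n + (1 - s) * v m n)"
        using that v0[of l n] v0[of m n] by (simp add: ennreal_mult ennreal_plus)
      finally show ?thesis using that v0[of l n] v0[of m n] 
        by (simp add: v_def[of "convex_comb s l m"] del: ennreal_plus)
    qed
    have v_lsc: "\<forall>\<^sub>F j in sequentially. r < v (X j) n"
      if X: "\<And>j. X j \<in> K" "l \<in> K" "functional_converges X l sequentially" and r: "r < v l n" for X l r n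
    proof (cases "r < 0")
      case True
      then show ?thesis by (intro always_eventually allI less_le_trans[OF True v0])
    next
      case False
      then have "ennreal r < l (q n)" using r by (simp add: v[OF X(2)] ennreal_less_iff)
      then have "\<forall>\<^sub>F j in sequentially. ennreal r < X j (q n)" by (rule functional_converges_liminf[OF X(3)])
      then show ?thesis using False by (simp add: v[OF X(1)] ennreal_less_iff)
    qed
    define d where "d N l m = real N * (\<Sum>n<N. max 0 (v l n - v m n))" for N :: nat and l m
    have d0: "0 \<le> d N l m" for N l m by (auto simp: d_def intro!: mult_nonneg_nonneg sum_nonneg)
    have d_refl: "d N l l = 0" for N l by (simp add: d_def)
    have d_comb: "d N (convex_comb s l l') (convex_comb s m m') \<le> s * d N l m + (1 - s) * d N l' m'"
      if "l \<in> K" "l' \<in> K" "m \<in> K" "m' \<in> K" and s: "0 < s" "s < 1" for N l l' m m' s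
    proof -
      have "max 0 (v (convex_comb s l l') n - v (convex_comb s m m') n) \<le>
          s * max 0 (v l n - v m n) + (1 - s) * max 0 (v l' n - v m' n)" (is "max 0 ?x \<le> ?r") for n
      proof -
        have "?x = s * (v l n - v m n) + (1 - s) * (v l' n - v m' n)"
          using that by (simp add: v_comb algebra_simps)
        also have "\<dots> \<le> ?r" using s by (intro add_mono mult_left_mono) auto
        finally have "?x \<le> ?r" .
        moreover have "0 \<le> ?r" using s by (intro add_nonneg_nonneg mult_nonneg_nonneg) auto
        ultimately show ?thesis by simp
      qed
      then have "(\<Sum>n<N. max 0 (v (convex_comb s l l') n - v (convex_comb s m m') n)) \<le>
          (\<Sum>n<N. s * max 0 (v l n - v m n) + (1 - s) * max 0 (v l' n - v m' n))"
        by (rule sum_mono)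
      then have "d N (convex_comb s l l') (convex_comb s m m') \<le>
          real N * (\<Sum>n<N. s * max 0 (v l n - v m n) + (1 - s) * max 0 (v l' n - v m' n))"
        unfolding d_def by (intro mult_left_mono) auto
      also have "\<dots> = s * d N l m + (1 - s) * d N l' m'"
        by (simp add: d_def sum.distrib distrib_left mult.left_commute flip: sum_distrib_left)
      finally show ?thesis .
    qed
    define \<phi> where "\<phi> N m = (INF l\<in>D. \<kappa> l + d N l m)" for N m
    have bdd: "bdd_below ((\<lambda>l. \<kappa> l + d N l m) ` D)" for N m
      using M d0 by (intro bdd_belowI2[of _ M]) (simp add: add_increasing2)
    have \<phi>_le: "\<phi> N m \<le> \<kappa> l + d N l m" if "l \<in> D" for N m l
      unfolding \<phi>_def using that bdd by (rule cINF_lower[rotated])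
    have \<phi>_less: "\<exists>l\<in>D. \<kappa> l + d N l m < r" if "\<phi> N m < r" for N m r
      using that unfolding \<phi>_def cINF_less_iff[OF ne bdd] .
    have \<phi>_k: "ereal (\<phi> N l) \<le> k l" if "l \<in> K" for N l
    proof (cases "l \<in> D")
      case True
      then show ?thesis using \<phi>_le[OF True, of N l] by (simp add: \<kappa> d_refl)
    qed (use that in \<open>simp add: D_def\<close>)
    \<comment> \<open>Near-minimizers for \<open>m\<close> and \<open>m'\<close> are combined with
      the same weights; \<open>k\<close> is affine and \<open>d\<close> jointly convex.\<close>
    have \<phi>_convex: "\<phi> N (convex_comb s m m') \<le> s * \<phi> N m + (1 - s) * \<phi> N m'"
      if m: "m \<in> K" "m' \<in> K" and s: "0 < s" "s < 1" for N m m' s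
    proof (rule field_le_epsilon)
      fix e :: real assume "0 < e"
      then obtain l l' where l: "l \<in> D" "\<kappa> l + d N l m < \<phi> N m + e"
        and l': "l' \<in> D" "\<kappa> l' + d N l' m' < \<phi> N m' + e"
        using \<phi>_less[of N m "\<phi> N m + e"] \<phi>_less[of N m' "\<phi> N m' + e"] by auto
      have lK: "l \<in> K" "l' \<in> K" using l l' DK by auto
      let ?c = "convex_comb s l l'"
      have "k ?c = ereal s * k l + ereal (1 - s) * k l'"
        using k lK s by (auto simp: LAff_def)
      then have kc: "k ?c = ereal (s * \<kappa> l + (1 - s) * \<kappa> l')" by (simp add: \<kappa> l(1) l'(1))
      then have cD: "?c \<in> D" using convex_comb_K[OF lK] s by (simp add: D_def)
      have "\<phi> N (convex_comb s m m') \<le> \<kappa> ?c + d N ?c (convex_comb s m m')" by (rule \<phi>_le[OF cD])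
      also have "\<dots> \<le> s * \<kappa> l + (1 - s) * \<kappa> l' + (s * d N l m + (1 - s) * d N l' m')"
        using d_comb[OF lK m s] kc by (simp add: \<kappa>_def)
      also have "\<dots> = s * (\<kappa> l + d N l m) + (1 - s) * (\<kappa> l' + d N l' m')" by (simp add: algebra_simps)
      also have "\<dots> \<le> s * (\<phi> N m + e) + (1 - s) * (\<phi> N m' + e)"
        using l(2) l'(2) s by (intro add_mono[OF mult_left_mono mult_left_mono]) auto
      also have "\<dots> = s * \<phi> N m + (1 - s) * \<phi> N m' + e" by (simp add: algebra_simps)
      finally show "\<phi> N (convex_comb s m m') \<le> s * \<phi> N m + (1 - s) * \<phi> N m' + e" .
    qed
    have \<phi>_usc: "\<forall>\<^sub>F j in sequentially. \<phi> N (X j) < r"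
      if X: "\<And>j. X j \<in> K" "m \<in> K" "functional_converges X m sequentially" and r: "\<phi> N m < r" for X m r N
    proof -
      obtain l where l: "l \<in> D" "\<kappa> l + d N l m < r" using \<phi>_less[OF r] by blast
      \<comment> \<open>A drop of at most \<open>e\<close> in each of the \<open>N\<close> tested
        values raises the penalty by at most \<open>N * N * e\<close>; the extra 1 makes the bound
        strict and the denominator positive.\<close>
      define e where "e = (r - (\<kappa> l + d N l m)) / (real N * real N + 1)"
      have N1: "0 < real N * real N + 1" by (simp add: add_nonneg_pos)
      then have e: "0 < e" "(real N * real N + 1) * e = r - (\<kappa> l + d N l m)"
        using l(2) by (simp_all add: e_def)
      have "\<forall>\<^sub>F j in sequentially. \<forall>n\<in>{..<N}. v m n - e < v (X j) n"
        using e(1) by (intro eventually_ball_finite) (auto intro!: v_lsc[OF X])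
      then show ?thesis
      proof eventually_elim
        case (elim j)
        have "(\<Sum>n<N. max 0 (v l n - v (X j) n)) \<le> (\<Sum>n<N. max 0 (v l n - v m n) + e)"
          using elim e(1) by (intro sum_mono) (force simp: max_def)
        then have "d N l (X j) \<le> real N * (\<Sum>n<N. max 0 (v l n - v m n) + e)"
          unfolding d_def by (intro mult_left_mono) auto
        also have "\<dots> = d N l m + real N * real N * e" by (simp add: d_def sum.distrib algebra_simps)
        also have "\<dots> < d N l m + (real N * real N + 1) * e" using e(1) by (simp add: algebra_simps)
        finally have "\<kappa> l + d N l (X j) < r" using e(2) by simp
        then show ?case using \<phi>_le[OF l(1), of N "X j"] by simp
      qed
    qed
    \<comment> \<open>Otherwise near-minimizers with bounded penalty subconverge to some
      \<open>l \<le> l0\<close>. Then \<open>l = l0\<close>, and lower semicontinuity of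
      \<open>k\<close> at \<open>l0\<close> contradicts their values below
      \<open>t'\<close>.\<close>
    have "\<exists>N. t < \<phi> N l0"
    proof (rule ccontr)
      assume "\<not> ?thesis"
      then have le: "\<phi> N l0 \<le> t" for N by (simp add: not_less)
      obtain t' where t': "t < t'" "ereal t' < k l0" using ereal_dense2[OF t] by auto
      have "\<forall>N. \<exists>l. l \<in> D \<and> \<kappa> l + d N l l0 < t'"
        using \<phi>_less[of _ l0 t'] le t'(1) by (meson order_le_less_trans)
      then obtain X where X: "\<And>N. X N \<in> D" "\<And>N. \<kappa> (X N) + d N (X N) l0 < t'" by metis
      have XK: "X N \<in> K" for N using X(1) DK by blast
      obtain s l where s: "strict_mono s" "l \<in> K" and conv: "functional_converges (X \<circ> s) l sequentially"
        using K_seq_compact[of X, OF XK] .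
      have XsK: "(X \<circ> s) j \<in> K" for j using XK by simp
      have "l (q n) \<le> l0 (q n)" for n
      proof (rule ccontr)
        assume "\<not> l (q n) \<le> l0 (q n)"
        then have "v l0 n < v l n" using v0 by (simp add: v s(2) l0)
        define e where "e = (v l n - v l0 n) / 2"
        have e: "0 < e" "v l0 n + e < v l n" using \<open>v l0 n < v l n\<close> by (simp_all add: e_def field_simps)
        \<comment> \<open>Once \<open>s j\<close> exceeds both \<open>n\<close> and
          \<open>J\<close>, the \<open>n\<close>-th gap is tested with weight at least
          \<open>J\<close>, so the penalty surpasses its bound \<open>t' - M\<close>.\<close>
        obtain J :: nat where J: "(t' - M) / e < real J" using reals_Archimedean2 by blast
        have "\<forall>\<^sub>F j in sequentially. v l0 n + e < v ((X \<circ> s) j) n"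
          by (rule v_lsc[OF XsK s(2) conv e(2)])
        moreover note eventually_ge_at_top[of "Suc n + J"]
        ultimately have "\<forall>\<^sub>F j :: nat in sequentially. False"
        proof eventually_elim
          case (elim j)
          have sj: "Suc n + J \<le> s j" using elim(2) seq_suble[OF s(1), of j] by simp
          have "max 0 (v (X (s j)) n - v l0 n) \<le> (\<Sum>i<s j. max 0 (v (X (s j)) i - v l0 i))"
            using sj by (intro member_le_sum) auto
          then have "e \<le> (\<Sum>i<s j. max 0 (v (X (s j)) i - v l0 i))" using elim(1) by simp
          then have "real (s j) * e \<le> d (s j) (X (s j)) l0" unfolding d_def by (intro mult_left_mono) auto
          also have "\<dots> < t' - M" using X(2)[of "s j"] M[OF X(1), of "s j"] by linarith
          also have "\<dots> < real J * e" using J e(1) by (simp add: divide_less_eq)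
          also have "\<dots> \<le> real (s j) * e" using sj e(1) by (intro mult_right_mono) auto
          finally show False by simp
        qed
        then show False by simp
      qed
      then have "l a \<le> l0 a" for a
        using q_range functionals_le_basis[OF K_functional[OF s(2)] K_functional[OF l0], of a]
        by (force simp: Bf_def)
      then have "l = l0" by (rule K_antichain[OF s(2) l0])
      then have "\<forall>\<^sub>F j in sequentially. ereal t' < k ((X \<circ> s) j)"
        using seq_lscD[OF LAff_seq_lsc[OF k] XsK s(2) conv] t'(2) by blast
      moreover have "k ((X \<circ> s) j) < ereal t'" for j
        using X(2)[of "s j"] d0[of "s j" "X (s j)" l0] by (simp add: \<kappa>[OF X(1)])
      ultimately show False by (auto simp: eventually_sequentially dest: order_less_asym)
    qed
    then obtain N where N: "t < \<phi> N l0" by blast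
    have 1: "concave_fun (\<lambda>l. - ereal (\<phi> N l))"
      using \<phi>_convex[of _ _ _ N] by (simp add: concave_fun_def algebra_simps)
    have 2: "seq_lsc (\<lambda>l. - ereal (\<phi> N l))"
      unfolding seq_lsc_def
    proof (intro allI impI, elim conjE)
      fix X l r
      assume X: "\<forall>j. X j \<in> K" "l \<in> K" "functional_converges X l sequentially"
        and r: "ereal r < - ereal (\<phi> N l)"
      have "\<forall>\<^sub>F j in sequentially. \<phi> N (X j) < - r"
        by (rule \<phi>_usc[OF X(1)[rule_format] X(2,3)]) (use r in simp)
      then show "\<forall>\<^sub>F j in sequentially. ereal r < - ereal (\<phi> N (X j))"
        by (rule eventually_mono) simp
    qed
    show ?thesis by (rule that[OF N _ 1 2]) (use \<phi>_k in blast)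
  qed
qed

text \<open>As \<open>- k\<close> need not be lower semicontinuous, \<open>k\<close> is replaced by
  a minorant \<open>\<phi>\<close> still above \<open>hat c\<close> at \<open>l0\<close>. Bauer's
  principle for \<open>hat c - \<phi>\<close> then moves the strict inequality to an extreme
  point.\<close>

lemma LAff_le_hat:
  assumes k: "k \<in> LAff K" and le: "\<And>l. l \<in> extreme_boundary K \<Longrightarrow> k l \<le> hat c l" and l0: "l0 \<in> K"
  shows "k l0 \<le> hat c l0"
proof (rule ccontr)
  assume "\<not> k l0 \<le> hat c l0"
  then have "hat c l0 < k l0" by simp
  then obtain t where t: "hat c l0 < ereal t" "ereal t < k l0" using ereal_dense2 by blast
  obtain \<phi> where \<phi>: "t < \<phi> l0" "\<forall>l\<in>K. ereal (\<phi> l) \<le> k l"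
    "concave_fun (\<lambda>l. - ereal (\<phi> l))" "seq_lsc (\<lambda>l. - ereal (\<phi> l))"
    using LAff_usc_minorant[OF k l0 t(2)] .
  define G where "G l = hat c l - ereal (\<phi> l)" for l
  have hat_nonneg: "0 \<le> hat c l" for l by (simp add: hat_def)
  have "seq_lsc G"
    unfolding seq_lsc_def
  proof (intro allI impI, elim conjE)
    fix X l r
    assume X: "\<forall>j. X j \<in> K" and l: "l \<in> K" and conv: "functional_converges X l sequentially"
      and r: "ereal r < G l"
    have "ereal (r + \<phi> l) < hat c l" using r by (cases "hat c l") (auto simp: G_def)
    \<comment> \<open>The threshold \<open>r\<close> is split as \<open>s + (r - s)\<close>, one
      part for \<open>hat c\<close> and one for \<open>- \<phi>\<close>.\<close>
    then obtain s where s: "r + \<phi> l < s" "ereal s < hat c l" using ereal_dense2 by (metis less_ereal.simps(1))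
    have XK: "X j \<in> K" for j using X by blast
    have "\<forall>\<^sub>F j in sequentially. ereal s < hat c (X j)"
      using seq_lscD[OF seq_lsc_hat XK l conv s(2)] .
    moreover have "\<forall>\<^sub>F j in sequentially. ereal (r - s) < - ereal (\<phi> (X j))"
      by (rule seq_lscD[OF \<phi>(4) XK l conv]) (use s(1) in simp)
    ultimately show "\<forall>\<^sub>F j in sequentially. ereal r < G (X j)"
    proof eventually_elim
      case (elim j)
      then show ?case by (cases "hat c (X j)") (auto simp: G_def)
    qed
  qed
  moreover have "concave_fun G"
    unfolding concave_fun_def
  proof (intro conjI ballI allI impI)
    show "G l \<noteq> - \<infinity>" for l using hat_nonneg[of l] by (cases "hat c l") (auto simp: G_def)
    fix l m s assume lm: "l \<in> K" "m \<in> K" and "0 < s \<and> s < (1::real)"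
    then have s: "0 < s" "s < 1" by auto
    have "\<phi> (convex_comb s l m) \<le> s * \<phi> l + (1 - s) * \<phi> m"
      using \<phi>(3) lm s by (fastforce simp: concave_fun_def algebra_simps)
    then show "ereal s * G l + ereal (1 - s) * G m \<le> G (convex_comb s l m)"
      using s hat_nonneg[of l] hat_nonneg[of m]
      by (cases "hat c l"; cases "hat c m") (auto simp: G_def hat_convex_comb algebra_simps)
  qed
  ultimately obtain l where l: "l \<in> extreme_boundary K" "G l \<le> G l0"
    using bauer_minimum l0 by blast
  have lK: "l \<in> K" using l(1) by (simp add: extreme_boundary_def)
  have "G l0 < 0" using t(1) \<phi>(1) by (cases "hat c l0") (auto simp: G_def)
  then have "G l < 0" using l(2) by simp
  then have "hat c l < ereal (\<phi> l)" using hat_nonneg[of l] by (cases "hat c l") (auto simp: G_def)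
  also have "\<dots> \<le> k l" using \<phi>(2) lK by blast
  also have "\<dots> \<le> hat c l" by (rule le[OF l(1)])
  finally show False by simp
qed

end

theorem theorem7p5:
  fixes u :: "'a::cu_semigroup"
  assumes "countably_based TYPE('a)"
    and "simple_cu TYPE('a)"
    and "stably_finite TYPE('a)"
    and "axiom_O5 TYPE('a)"
    and "axiom_O6_plus TYPE('a)"
    and "compact_element u"
    and "full_element u"
    and "K = normalized_functionals u"
    and "edwards_condition (extreme_boundary K)"
  shows "\<forall>a b. \<exists>c. c \<le> a \<and> c \<le> b \<and>
    is_LAff_inf K (restrict (hat a) K) (restrict (hat b) K) (restrict (hat c) K)"
proof (intro allI)
  fix a b :: 'a
  obtain B :: "'a set" where "countable B"
    "\<forall>a. \<exists>f. (\<forall>n. f n \<in> B) \<and> (\<forall>n. f n \<le> f (Suc n)) \<and> is_seq_sup f a"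
    using assms(1) unfolding countably_based_def by blast
  then interpret normalized_cu B u K
    using assms by unfold_locales auto
  obtain c where c: "c \<le> a" "c \<le> b"
    "\<And>p s l. p \<le> a \<Longrightarrow> p \<le> b + s \<Longrightarrow> l \<in> K \<Longrightarrow> l p \<le> l c + l s"
    using large_lower_bound[OF assms(5)] by blast
  \<comment> \<open>At extreme points \<open>c\<close> attains the pointwise minimum; elsewhere on K
    that minimum may be larger than the infimum in \<open>LAff K\<close>.\<close>
  have extreme: "min (hat a l) (hat b l) \<le> hat c l" if "l \<in> extreme_boundary K" for l
  proof -
    have lK: "l \<in> K" using that by (simp add: extreme_boundary_def)
    have "min (l a) (l b) \<le> l c"
      by (rule edwards_lower_bound[OF assms(9) that lK c(3)[OF _ _ lK]])
    then have "l a \<le> l c \<or> l b \<le> l c" by (simp only: min_le_iff_disj)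
    then show ?thesis unfolding hat_def min_le_iff_disj less_eq_ennreal.rep_eq .
  qed
  have mono: "hat c l \<le> hat d l" if "c \<le> d" "l \<in> K" for d l
    using K_mono[OF that(2,1)] by (simp add: hat_def less_eq_ennreal.rep_eq)
  \<comment> \<open>Any \<open>k\<close> in \<open>LAff K\<close> below both functions is below
    their minimum, hence below \<open>hat c\<close>, at extreme points; \<open>LAff_le_hat\<close>
    extends this to K.\<close>
  have "k l \<le> hat c l"
    if k: "k \<in> LAff K" "\<forall>l\<in>K. k l \<le> hat a l" "\<forall>l\<in>K. k l \<le> hat b l" and l: "l \<in> K" for k l
  proof (rule LAff_le_hat[OF k(1) _ l])
    fix m assume m: "m \<in> extreme_boundary K"
    then have "m \<in> K" by (simp add: extreme_boundary_def)
    then have "k m \<le> min (hat a m) (hat b m)" using k(2,3) by simp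
    also have "\<dots> \<le> hat c m" by (rule extreme[OF m])
    finally show "k m \<le> hat c m" .
  qed
  then have "is_LAff_inf K (restrict (hat a) K) (restrict (hat b) K) (restrict (hat c) K)"
    unfolding is_LAff_inf_def using hat_LAff mono c(1,2) by simp
  then show "\<exists>c. c \<le> a \<and> c \<le> b \<and>
      is_LAff_inf K (restrict (hat a) K) (restrict (hat b) K) (restrict (hat c) K)"
    using c(1,2) by blast
qed

end
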